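(* There exist a sofic group $\Gamma$, a sofic approximation $\Lambda$ to $\Gamma$, and a probability-measure-preserving action $\Gamma\curvearrowright^T(X,\mu)$ such that $$h_{\Lambda,\mu\times\mu}(T\times T)=-\infty\neq 0=2\,h_{\Lambda,\mu}(T),$$ where $T\times T$ is the diagonal action on $X\times X$ given by $(T\times T)^g(x,y)=(T^gx,T^gy)$.
   Context: All probability spaces are standard. Sofic approximation to a countable group $\Gamma$: a sequence $\Sigma=\{\sigma_i:\Gamma\to\mathrm{Sym}(V_i)\}$ of maps, $V_i$ finite sets, $|V_i|\to\infty$, such that for all $g,h\in\Gamma$, $|V_i|^{-1}\#\{p\in V_i:\sigma_i(g)\sigma_i(h)p=\sigma_i(gh)p\}\to1$, and for all $g\ne e$, $|V_i|^{-1}\#\{p\in V_i:\sigma_i(g)p=p\}\to0$. A countable group is sofic if it admits a sofic approximation. Measure sofic entropy: suppose $\Gamma$ acts by homeomorphisms $T^g$ on a compact metrizable space $X$ preserving a Borel probability measure $\mu$. Let $\rho$ be a continuous generating pseudometric on $X$ (generating: for $x\neq y$ there is $g$ with $\rho(T^gx,T^gy)>0$). For a finite set $V$ and $x,y\in X^V$ let $\rho_\infty(x,y)=\max_v\rho(x_v,y_v)$ and $\rho_2(x,y)=(|V|^{-1}\sum_v\rho(x_v,y_v)^2)^{1/2}$. For $F\subset\Gamma$ finite, $\delta>0$, a weak* open neighborhood $O$ of $\mu$ in $\mathrm{Prob}(X)$, and $\sigma:\Gamma\to\mathrm{Sym}(V)$, let $\mathrm{Map}(T,\rho,O,F,\delta,\sigma)$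 be the set of $x\in X^V$ with $\rho_2(T^fx,x\circ\sigma(f))<\delta$ for all $f\in F$ (where $(T^fx)_v=T^fx_v$ and $(x\circ\sigma(f))_v=x_{\sigma(f)v}$) and $|V|^{-1}\sum_v\delta_{x_v}\in O$. Let $N_\epsilon(S,\rho_\infty)$ be the maximum cardinality of a subset of $S$ whose distinct points are at $\rho_\infty$-distance $\ge\epsilon$. Then $h_{\Sigma,\mu}(T)=\sup_{\epsilon>0}\inf_O\inf_F\inf_{\delta>0}\limsup_i|V_i|^{-1}\log N_\epsilon(\mathrm{Map}(T,\rho,O,F,\delta,\sigma_i),\rho_\infty)$, with $\log0=-\infty$. This is independent of $\rho$ and of the compact topological model chosen for a given pmp action. *)

theory Defs
  imports
    "HOL-Probability.Probability"
    "HOL-Algebra.Group_Action"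
    "HOL-Combinatorics.Permutations"
begin

text \<open>The group \<open>Sym(V)\<close> is represented by the functions that permute \<open>V\<close>, that is, the bijections
  of the ambient type which are the identity outside \<open>V\<close>.\<close>

definition sofic_approximation ::
    "('g, 'm) monoid_scheme \<Rightarrow> (nat \<Rightarrow> 'v set) \<Rightarrow> (nat \<Rightarrow> 'g \<Rightarrow> 'v \<Rightarrow> 'v) \<Rightarrow> bool" where
  "sofic_approximation G V \<sigma> \<longleftrightarrow>
     (\<forall>i. finite (V i)) \<and>
     (\<forall>i. \<forall>g\<in>carrier G. \<sigma> i g permutes V i) \<and>
     filterlim (\<lambda>i. card (V i)) at_top sequentially \<and>
     (\<forall>g\<in>carrier G. \<forall>h\<in>carrier G.
        (\<lambda>i. real (card {p \<in> V i. \<sigma> i g (\<sigma> i h p) = \<sigma> i (g \<otimes>\<^bsub>G\<^esub> h) p}) / real (card (V i)))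
          \<longlonglongrightarrow> 1) \<and>
     (\<forall>g\<in>carrier G. g \<noteq> \<one>\<^bsub>G\<^esub> \<longrightarrow>
        (\<lambda>i. real (card {p \<in> V i. \<sigma> i g p = p}) / real (card (V i))) \<longlonglongrightarrow> 0)"

text \<open>Since the sets \<open>V i\<close> are finite, taking them to be sets of natural numbers loses no
  generality.\<close>

definition sofic_group :: "('g, 'm) monoid_scheme \<Rightarrow> bool" where
  "sofic_group G \<longleftrightarrow> group G \<and> countable (carrier G) \<and>
     (\<exists>(V :: nat \<Rightarrow> nat set) \<sigma>. sofic_approximation G V \<sigma>)"

definition borel_of :: "'a topology \<Rightarrow> 'a measure" where
  "borel_of X = sigma (topspace X) {U. openin X U}"

definition Prob :: "'a topology \<Rightarrow> 'a measure set" where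
  "Prob X = {\<nu>. prob_space \<nu> \<and> sets \<nu> = sets (borel_of X)}"

text \<open>On a compact space every continuous real function is bounded, so these functions are the
  test functions of the weak* topology.\<close>

definition weak_star :: "'a topology \<Rightarrow> 'a measure topology" where
  "weak_star X = topology_generated_by
     {{\<nu> \<in> Prob X. (\<integral>x. f x \<partial>\<nu>) \<in> U} | f U. continuous_map X euclideanreal f \<and> open U}"

text \<open>A probability-measure-preserving action given by a compact topological model.
  The predicate \<open>group_action\<close> makes each \<open>T g\<close> a bijection of \<open>topspace X\<close> with the conventional
  value \<open>undefined\<close> outside.\<close>

definition compact_pmp_action ::
    "('g, 'm) monoid_scheme \<Rightarrow> 'a topology \<Rightarrow> 'a measure \<Rightarrow> ('g \<Rightarrow> 'a \<Rightarrow> 'a) \<Rightarrow> bool" where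
  "compact_pmp_action G X \<mu> T \<longleftrightarrow>
     compact_space X \<and> metrizable_space X \<and>
     group_action G (topspace X) T \<and>
     (\<forall>g\<in>carrier G. homeomorphic_map X X (T g)) \<and>
     \<mu> \<in> Prob X \<and>
     (\<forall>g\<in>carrier G. distr \<mu> \<mu> (T g) = \<mu>)"

definition diagonal_action ::
    "'a topology \<Rightarrow> ('g \<Rightarrow> 'a \<Rightarrow> 'a) \<Rightarrow> 'g \<Rightarrow> 'a \<times> 'a \<Rightarrow> 'a \<times> 'a" where
  "diagonal_action X T g = (\<lambda>(x, y)\<in>topspace X \<times> topspace X. (T g x, T g y))"

definition continuous_pseudometric :: "'a topology \<Rightarrow> ('a \<Rightarrow> 'a \<Rightarrow> real) \<Rightarrow> bool" where
  "continuous_pseudometric X \<rho> \<longleftrightarrow>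
     (\<forall>x\<in>topspace X. \<forall>y\<in>topspace X. 0 \<le> \<rho> x y \<and> \<rho> x y = \<rho> y x) \<and>
     (\<forall>x\<in>topspace X. \<rho> x x = 0) \<and>
     (\<forall>x\<in>topspace X. \<forall>y\<in>topspace X. \<forall>z\<in>topspace X. \<rho> x z \<le> \<rho> x y + \<rho> y z) \<and>
     continuous_map (prod_topology X X) euclideanreal (\<lambda>(x, y). \<rho> x y)"

definition generating_pseudometric ::
    "('g, 'm) monoid_scheme \<Rightarrow> 'a topology \<Rightarrow> ('g \<Rightarrow> 'a \<Rightarrow> 'a) \<Rightarrow> ('a \<Rightarrow> 'a \<Rightarrow> real) \<Rightarrow> bool" where
  "generating_pseudometric G X T \<rho> \<longleftrightarrow>
     continuous_pseudometric X \<rho> \<and>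
     (\<forall>x\<in>topspace X. \<forall>y\<in>topspace X. x \<noteq> y \<longrightarrow> (\<exists>g\<in>carrier G. \<rho> (T g x) (T g y) > 0))"

lemma generating_pseudometric_exists:
  assumes "metrizable_space X" and "\<one>\<^bsub>G\<^esub> \<in> carrier G"
    and T_one: "\<And>x. x \<in> topspace X \<Longrightarrow> T \<one>\<^bsub>G\<^esub> x = x"
  shows "\<exists>\<rho>. generating_pseudometric G X T \<rho>"
proof -
  obtain M d where md: "Metric_space M d" and X: "X = Metric_space.mtopology M d"
    using assms unfolding metrizable_space_def by blast
  interpret Metric_space M d by (fact md)
  have "continuous_map (prod_topology X X) euclideanreal (\<lambda>(x, y). d x y)"
    using continuous_map_metric[of "metric (M, d)"] by (simp add: X mtopology_of)
  then have "continuous_pseudometric X d"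
    unfolding continuous_pseudometric_def
    by (auto simp: X commute triangle)
  moreover have "d (T \<one>\<^bsub>G\<^esub> x) (T \<one>\<^bsub>G\<^esub> y) > 0" if "x \<in> topspace X" "y \<in> topspace X" "x \<noteq> y" for x y
    using that T_one by (simp add: X)
  ultimately show ?thesis
    unfolding generating_pseudometric_def using assms(2) by blast
qed

lemma compact_pmp_action_generating_pseudometric_exists:
  assumes "compact_pmp_action G X \<mu> T"
  shows "\<exists>\<rho>. generating_pseudometric G X T \<rho>"
    and "\<exists>\<rho>. generating_pseudometric G (prod_topology X X) (diagonal_action X T) \<rho>"
proof -
  interpret group_action G "topspace X" T
    using assms unfolding compact_pmp_action_def by blast
  have met: "metrizable_space X"
    using assms unfolding compact_pmp_action_def by blast
  have one: "\<one>\<^bsub>G\<^esub> \<in> carrier G"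
    using group_hom unfolding group_hom_def by (simp add: group.is_monoid monoid.one_closed)
  have T_one: "T \<one>\<^bsub>G\<^esub> x = x" if "x \<in> topspace X" for x
    using that id_eq_one by (metis restrict_apply')
  show "\<exists>\<rho>. generating_pseudometric G X T \<rho>"
    by (rule generating_pseudometric_exists) (simp_all add: met one T_one)
  show "\<exists>\<rho>. generating_pseudometric G (prod_topology X X) (diagonal_action X T) \<rho>"
    by (rule generating_pseudometric_exists)
      (auto simp: one metrizable_space_prod_topology met diagonal_action_def T_one)
qed

definition rho_inf :: "('a \<Rightarrow> 'a \<Rightarrow> real) \<Rightarrow> 'v set \<Rightarrow> ('v \<Rightarrow> 'a) \<Rightarrow> ('v \<Rightarrow> 'a) \<Rightarrow> real" where
  "rho_inf \<rho> V x y = (MAX v\<in>V. \<rho> (x v) (y v))"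

definition rho_two :: "('a \<Rightarrow> 'a \<Rightarrow> real) \<Rightarrow> 'v set \<Rightarrow> ('v \<Rightarrow> 'a) \<Rightarrow> ('v \<Rightarrow> 'a) \<Rightarrow> real" where
  "rho_two \<rho> V x y = sqrt ((\<Sum>v\<in>V. (\<rho> (x v) (y v))\<^sup>2) / real (card V))"

definition empirical_measure :: "'a topology \<Rightarrow> 'v set \<Rightarrow> ('v \<Rightarrow> 'a) \<Rightarrow> 'a measure" where
  "empirical_measure X V x = distr (uniform_count_measure V) (borel_of X) x"

definition Map ::
    "'a topology \<Rightarrow> ('g \<Rightarrow> 'a \<Rightarrow> 'a) \<Rightarrow> ('a \<Rightarrow> 'a \<Rightarrow> real) \<Rightarrow> 'a measure set \<Rightarrow> 'g set \<Rightarrow> real \<Rightarrow>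
     'v set \<Rightarrow> ('g \<Rightarrow> 'v \<Rightarrow> 'v) \<Rightarrow> ('v \<Rightarrow> 'a) set" where
  "Map X T \<rho> U F \<delta> V \<sigma> =
     {x \<in> V \<rightarrow>\<^sub>E topspace X.
        (\<forall>f\<in>F. rho_two \<rho> V (\<lambda>v. T f (x v)) (\<lambda>v. x (\<sigma> f v)) < \<delta>) \<and>
        empirical_measure X V x \<in> U}"

text \<open>For a compact space and a continuous pseudometric, separated subsets of \<open>X\<^sup>V\<close> are finite and
  of bounded cardinality, so that the maximum below is attained.\<close>

definition separation_number ::
    "real \<Rightarrow> ('v \<Rightarrow> 'a) set \<Rightarrow> ('a \<Rightarrow> 'a \<Rightarrow> real) \<Rightarrow> 'v set \<Rightarrow> nat" where
  "separation_number \<epsilon> S \<rho> V =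
     Max {card A | A. finite A \<and> A \<subseteq> S \<and> (\<forall>x\<in>A. \<forall>y\<in>A. x \<noteq> y \<longrightarrow> \<epsilon> \<le> rho_inf \<rho> V x y)}"

definition normalized_log :: "nat \<Rightarrow> nat \<Rightarrow> ereal" where
  "normalized_log m n = (if n = 0 then -\<infinity> else ereal (ln (real n) / real m))"

definition sofic_entropy ::
    "('g, 'm) monoid_scheme \<Rightarrow> (nat \<Rightarrow> 'v set) \<Rightarrow> (nat \<Rightarrow> 'g \<Rightarrow> 'v \<Rightarrow> 'v) \<Rightarrow>
     'a topology \<Rightarrow> 'a measure \<Rightarrow> ('g \<Rightarrow> 'a \<Rightarrow> 'a) \<Rightarrow> ('a \<Rightarrow> 'a \<Rightarrow> real) \<Rightarrow> ereal" where
  "sofic_entropy G V \<sigma> X \<mu> T \<rho> =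
     (SUP \<epsilon>\<in>{0<..}. INF U\<in>{U. openin (weak_star X) U \<and> \<mu> \<in> U}.
        INF F\<in>{F. finite F \<and> F \<subseteq> carrier G}. INF \<delta>\<in>{0<..}.
          limsup (\<lambda>i. normalized_log (card (V i))
            (separation_number \<epsilon> (Map X T \<rho> U F \<delta> (V i) (\<sigma> i)) \<rho> (V i))))"

end

theory Submission
  imports Defs "HOL-Library.Z2" "HOL-Computational_Algebra.Polynomial"
begin

text \<open>The action is the trivial one on a two-point space with the fair coin measure, and the sofic
approximation consists of two disjoint copies \<open>P\<close>, \<open>Q\<close> of one expander. A microstate of a trivial
action is a colouring whose colour classes are nearly invariant under finitely many group elements
(\<open>microstate_level_sets\<close>). In an expander a nearly invariant set is almost empty or almost full, so
in \<open>P \<union> Q\<close> it is close to one of \<open>{}\<close>, \<open>P\<close>, \<open>Q\<close>, \<open>P \<union> Q\<close> and has density close to \<open>0\<close>, \<open>1/2\<close> or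
\<open>1\<close> (\<open>nearly_invariant_sets\<close>).

For the square of the action the colour \<open>(1, 1)\<close> would have to occupy a nearly invariant set of
density close to \<open>1/4\<close>. There is none, so there are no microstates at all and the entropy is
\<open>-\<infinity>\<close>. For the action itself, colouring \<open>P\<close> by \<open>1\<close> and \<open>Q\<close> by \<open>0\<close> is an exact microstate, so the
entropy is nonnegative; and all microstates lie in four small Hamming balls, whose sizes
grow at an arbitrarily small exponential rate, so the entropy is not positive.

It remains to find expanders that form a sofic approximation. Let \<open>SL\<^sub>2(R) \<ltimes> R\<^sup>2\<close>
with \<open>R = F\<^sub>2[t]\<close> act by affine maps on the finite planes \<open>(R/t\<^sup>m)\<^sup>2\<close>. These are honest actions, and
a nontrivial affine map fixes few points once \<open>m\<close> is large (\<open>eventually_few_fixed_points\<close>). Expansion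
(\<open>plane_expansion\<close>) is proved with the Fourier transform. If \<open>A\<close> is nearly invariant, the mass that the
squared transform of its indicator function puts on nonzero frequencies is nearly invariant under
transposed shears, and near-invariance under the translations by \<open>1\<close> and \<open>t\<close> confines nearly all of it
to frequencies of degree less than \<open>m - 2\<close>, where shears by \<open>t\<close> and \<open>t\<^sup>2\<close> act without wrapping around. The
half of these frequencies with \<open>deg x \<le> deg y\<close> is disjoint from its images under the shears by \<open>t\<close>
and \<open>t\<^sup>2\<close>, as these produce \<open>deg x = deg y + 1\<close> and \<open>deg x = deg y + 2\<close>. So it carries about a third
of the mass at most, and so does the other half. Hence the total mass \<open>|A| |A\<^sup>c|\<close> is small.\<close>

section \<open>Microstates of a trivial action on a finite set\<close>

definition displaced :: "('v \<Rightarrow> 'v) \<Rightarrow> 'v set \<Rightarrow> 'v set \<Rightarrow> 'v set" where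
  "displaced s W A = {v \<in> W. (v \<in> A) \<noteq> (s v \<in> A)}"

abbreviation trivial_action :: "'a set \<Rightarrow> 'g \<Rightarrow> 'a \<Rightarrow> 'a" where
  "trivial_action S \<equiv> (\<lambda>g. \<lambda>x\<in>S. x)"

lemma sets_borel_of_discrete: "sets (borel_of (discrete_topology S)) = Pow S"
proof -
  have "sigma_sets S (Pow S) = Pow S"
    by (rule sigma_algebra.sigma_sets_eq) (rule sigma_algebra_Pow)
  then show ?thesis
    by (simp add: borel_of_def Pow_def)
qed

lemma space_borel_of_discrete: "space (borel_of (discrete_topology S)) = S"
  by (simp add: borel_of_def space_measure_of_conv)

lemma trivial_action_compact_pmp:
  assumes "group G" "finite S" and \<mu>: "\<mu> \<in> Prob (discrete_topology S)"
  shows "compact_pmp_action G (discrete_topology S) \<mu> (trivial_action S)"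
proof -
  have "group_action G S (trivial_action S)"
    unfolding group_action_def group_hom_def group_hom_axioms_def
    using assms(1) group_BijGroup[of S]
    by (auto simp: hom_def BijGroup_def Bij_def bij_betw_def inj_on_def compose_def fun_eq_iff)
  moreover have "distr \<mu> \<mu> (\<lambda>x\<in>S. x) = \<mu>"
  proof -
    have "space \<mu> = S"
      using \<mu> sets_eq_imp_space_eq[of \<mu> "borel_of (discrete_topology S)"]
      by (auto simp: Prob_def space_borel_of_discrete)
    then have "distr \<mu> \<mu> (\<lambda>x\<in>S. x) = distr \<mu> \<mu> (\<lambda>x. x)"
      by (intro distr_cong) auto
    then show ?thesis by simp
  qed
  moreover have "homeomorphic_map (discrete_topology S) (discrete_topology S) (\<lambda>x\<in>S. x)"
    by (rule homeomorphic_map_eq[OF homeomorphic_map_id[THEN iffD2]]) auto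
  ultimately show ?thesis
    unfolding compact_pmp_action_def
    using assms by (auto simp: compact_space_discrete_topology metrizable_space_discrete_topology)
qed

lemma diagonal_trivial_action:
  "diagonal_action (discrete_topology S) (trivial_action S) = trivial_action (S \<times> S)"
  by (auto simp: diagonal_action_def fun_eq_iff)

text \<open>All translates of \<open>\<rho>\<close> under a trivial action are \<open>\<rho>\<close> itself, so a generating \<open>\<rho>\<close> separates points, and
on a finite set it does so by a positive distance.\<close>

lemma generating_trivial_action_gap:
  assumes "finite S" and "generating_pseudometric G (discrete_topology S) (trivial_action S) \<rho>"
  shows "\<exists>c>0. \<forall>x\<in>S. \<forall>y\<in>S. x \<noteq> y \<longrightarrow> c \<le> \<rho> x y"
proof -
  define D where "D = insert 1 ((\<lambda>(x, y). \<rho> x y) ` {(x, y) \<in> S \<times> S. x \<noteq> y})"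
  have "finite D"
    unfolding D_def using assms(1) by (auto intro: finite_subset[of _ "S \<times> S"])
  moreover have "D \<noteq> {}" "\<forall>d\<in>D. d > 0"
    using assms(2) by (auto simp: D_def generating_pseudometric_def)
  ultimately have "Min D > 0" "\<forall>d\<in>D. Min D \<le> d" by simp_all
  then show ?thesis
    by (intro exI[of _ "Min D"]) (auto simp: D_def)
qed

text \<open>Chebyshev's inequality: every point \<open>v\<close> at which a level set is not invariant has
\<open>x v \<noteq> x (\<sigma> g v)\<close> and contributes at least \<open>c\<^sup>2\<close> to the sum of squares in \<open>rho_two\<close>.\<close>

lemma microstate_level_sets:
  assumes "finite V" "finite S" and c: "c > 0" "\<forall>x\<in>S. \<forall>y\<in>S. x \<noteq> y \<longrightarrow> c \<le> \<rho> x y"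
    and x: "x \<in> Map (discrete_topology S) (trivial_action S) \<rho> U F (c * sqrt \<delta>) V \<sigma>"
    and g: "g \<in> F" "\<sigma> g permutes V" and "\<delta> > 0"
  shows "card (displaced (\<sigma> g) V {v \<in> V. x v \<in> E}) \<le> \<delta> * real (card V)"
proof (cases "V = {}")
  case True
  then show ?thesis by (simp add: displaced_def)
next
  case False
  define B where "B = displaced (\<sigma> g) V {v \<in> V. x v \<in> E}"
  have n: "card V > 0" using False assms(1) by (simp add: card_gt_0_iff)
  have xS: "x v \<in> S" if "v \<in> V" for v
    using x that by (auto simp: Map_def)
  have gV: "\<sigma> g v \<in> V" if "v \<in> V" for v
    using g(2) that by (simp add: permutes_in_image)
  let ?d = "\<lambda>v. \<rho> (x v) (x (\<sigma> g v))"
  have "rho_two \<rho> V (\<lambda>v. trivial_action S g (x v)) (\<lambda>v. x (\<sigma> g v)) < c * sqrt \<delta>"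
    using x g(1) by (simp add: Map_def)
  moreover have "rho_two \<rho> V (\<lambda>v. trivial_action S g (x v)) (\<lambda>v. x (\<sigma> g v))
      = sqrt ((\<Sum>v\<in>V. (?d v)\<^sup>2) / card V)"
    unfolding rho_two_def by (simp add: xS cong: sum.cong)
  ultimately have "sqrt ((\<Sum>v\<in>V. (?d v)\<^sup>2) / card V) < sqrt (c\<^sup>2 * \<delta>)"
    using c(1) by (simp add: real_sqrt_mult)
  then have "(\<Sum>v\<in>V. (?d v)\<^sup>2) < c\<^sup>2 * \<delta> * card V"
    using n by (simp add: field_simps)
  moreover have "c\<^sup>2 * card B \<le> (\<Sum>v\<in>V. (?d v)\<^sup>2)"
  proof -
    have "c\<^sup>2 \<le> (?d v)\<^sup>2" if "v \<in> B" for v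
    proof -
      have "v \<in> V" "x v \<noteq> x (\<sigma> g v)"
        using that gV by (auto simp: B_def displaced_def)
      then show ?thesis
        using c xS gV by (intro power_mono) auto
    qed
    then have "(\<Sum>v\<in>B. c\<^sup>2) \<le> (\<Sum>v\<in>B. (?d v)\<^sup>2)"
      by (rule sum_mono)
    also have "\<dots> \<le> (\<Sum>v\<in>V. (?d v)\<^sup>2)"
      by (rule sum_mono2) (auto simp: B_def displaced_def assms(1))
    finally show ?thesis by (simp add: mult.commute)
  qed
  ultimately have "c\<^sup>2 * card B < c\<^sup>2 * (\<delta> * real (card V))" by (simp add: mult.assoc)
  then show ?thesis using c(1) by (simp add: B_def)
qed

lemma emeasure_empirical_measure:
  assumes "finite V" "V \<noteq> {}" "x \<in> V \<rightarrow> S" "E \<subseteq> S"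
  shows "emeasure (empirical_measure (discrete_topology S) V x) E
    = card {v \<in> V. x v \<in> E} / card V"
proof -
  have "x \<in> uniform_count_measure V \<rightarrow>\<^sub>M borel_of (discrete_topology S)"
    using assms(3) by (auto simp: measurable_def sets_borel_of_discrete space_borel_of_discrete
        space_uniform_count_measure sets_uniform_count_measure)
  then have "emeasure (empirical_measure (discrete_topology S) V x) E
      = emeasure (uniform_count_measure V) (x -` E \<inter> V)"
    unfolding empirical_measure_def
    by (subst emeasure_distr)
      (auto simp: sets_borel_of_discrete assms(4) space_uniform_count_measure)
  also have "x -` E \<inter> V = {v \<in> V. x v \<in> E}" by auto
  finally show ?thesis
    using assms by (simp add: emeasure_uniform_count_measure)
qed

lemma sets_empirical_measure:
  "sets (empirical_measure (discrete_topology S) V x) = Pow S"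
  by (simp add: empirical_measure_def sets_borel_of_discrete)

text \<open>In a discrete space the indicator function of a point is a weak* test function.\<close>

lemma weak_star_neighbourhood_frequency:
  assumes \<mu>: "\<mu> \<in> Prob (discrete_topology S)" and "s \<in> S" "\<eta> > 0"
  shows "\<exists>U. openin (weak_star (discrete_topology S)) U \<and> \<mu> \<in> U \<and>
    (\<forall>(V :: 'v set) x. finite V \<longrightarrow> V \<noteq> {} \<longrightarrow> x \<in> V \<rightarrow> S \<longrightarrow>
       empirical_measure (discrete_topology S) V x \<in> U \<longrightarrow>
       \<bar>card {v \<in> V. x v = s} / card V - measure \<mu> {s}\<bar> < \<eta>)"
proof -
  let ?X = "discrete_topology S"
  define f :: "_ \<Rightarrow> real" where "f = indicator {s}"
  define J where "J = ball (measure \<mu> {s}) \<eta>"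
  define U where "U = {\<nu> \<in> Prob ?X. (\<integral>x. f x \<partial>\<nu>) \<in> J}"
  have int: "(\<integral>x. f x \<partial>\<nu>) = measure \<nu> {s}" if "{s} \<in> sets \<nu>" for \<nu>
    using that by (simp add: f_def sets.sets_into_space Int_absorb2)
  have "continuous_map ?X euclideanreal f" by simp
  then have "openin (weak_star ?X) U"
    unfolding weak_star_def U_def J_def
    by (intro topology_generated_by_Basis) blast
  moreover have "\<mu> \<in> U"
    using \<mu> assms by (auto simp: U_def J_def Prob_def sets_borel_of_discrete int)
  moreover have "\<bar>card {v \<in> V. x v = s} / card V - measure \<mu> {s}\<bar> < \<eta>"
    if "finite V" "V \<noteq> {}" "x \<in> V \<rightarrow> S" "empirical_measure ?X V x \<in> U" for V :: "'v set" and x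
  proof -
    have "measure (empirical_measure ?X V x) {s} = card {v \<in> V. x v = s} / card V"
      using emeasure_empirical_measure[OF that(1-3), of "{s}"] assms(2)
      by (simp add: measure_def)
    moreover have "measure (empirical_measure ?X V x) {s} \<in> J"
      using that(4) assms(2) by (simp add: U_def int sets_empirical_measure)
    ultimately show ?thesis by (simp add: J_def dist_real_def abs_minus_commute)
  qed
  ultimately show ?thesis by blast
qed


section \<open>Nearly invariant sets in two expanders\<close>

text \<open>A qualitative, isoperimetric form of expansion, uniform in \<open>i\<close>: only sets that are almost empty or
almost full can have small boundary. This is what the counting arguments consume.\<close>

definition expander_sequence :: "'g set \<Rightarrow> (nat \<Rightarrow> 'v set) \<Rightarrow> (nat \<Rightarrow> 'g \<Rightarrow> 'v \<Rightarrow> 'v) \<Rightarrow> bool" where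
  "expander_sequence F W \<sigma> \<longleftrightarrow>
     (\<forall>\<eta>>0. \<exists>\<delta>>0. \<forall>i. \<forall>A\<subseteq>W i.
        (\<forall>g\<in>F. real (card (displaced (\<sigma> i g) (W i) A)) \<le> \<delta> * real (card (W i))) \<longrightarrow>
        real (card A) \<le> \<eta> * real (card (W i)) \<or> real (card (W i - A)) \<le> \<eta> * real (card (W i)))"

locale two_expanders =
  fixes G :: "('g, 'm) monoid_scheme" and F :: "'g set"
    and P Q :: "nat \<Rightarrow> 'v set" and \<sigma> :: "nat \<Rightarrow> 'g \<Rightarrow> 'v \<Rightarrow> 'v"
  assumes sofic: "sofic_approximation G (\<lambda>i. P i \<union> Q i) \<sigma>"
    and F: "finite F" "F \<subseteq> carrier G"
    and disjoint: "P i \<inter> Q i = {}"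
    and card_eq: "card (P i) = card (Q i)"
    and nonempty: "P i \<noteq> {}"
    and invariant: "g \<in> carrier G \<Longrightarrow> v \<in> P i \<union> Q i \<Longrightarrow> \<sigma> i g v \<in> P i \<longleftrightarrow> v \<in> P i"
    and expander: "expander_sequence F P \<sigma>" "expander_sequence F Q \<sigma>"
begin

abbreviation V :: "nat \<Rightarrow> 'v set" where "V i \<equiv> P i \<union> Q i"

lemma finite_V: "finite (V i)" and finite_P: "finite (P i)" and finite_Q: "finite (Q i)"
  using sofic by (auto simp: sofic_approximation_def)

lemma permutes: "g \<in> carrier G \<Longrightarrow> \<sigma> i g permutes V i"
  using sofic by (simp add: sofic_approximation_def)

lemma card_V: "card (V i) = 2 * card (P i)"
  using card_Un_disjoint[OF finite_P finite_Q disjoint] card_eq by simp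

lemma card_V_pos: "card (V i) > 0"
  using nonempty finite_V by (auto simp: card_gt_0_iff)

text \<open>Both copies are invariant, so a nearly invariant set meets each of them in a nearly invariant set,
and expansion applies to the two pieces separately.\<close>

lemma nearly_invariant_sets:
  assumes "\<eta> > 0"
  shows "\<exists>\<delta>>0. \<forall>i. \<forall>A\<subseteq>V i.
    (\<forall>g\<in>F. real (card (displaced (\<sigma> i g) (V i) A)) \<le> \<delta> * real (card (V i))) \<longrightarrow>
    (\<exists>B\<in>{{}, P i, Q i, V i}. real (card (sym_diff A B)) \<le> \<eta> * real (card (V i)))"
proof -
  obtain \<delta>1 where \<delta>1: "\<delta>1 > 0" and P: "\<And>i A. A \<subseteq> P i \<Longrightarrow>
        \<forall>g\<in>F. real (card (displaced (\<sigma> i g) (P i) A)) \<le> \<delta>1 * real (card (P i)) \<Longrightarrow>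
        real (card A) \<le> \<eta> * real (card (P i)) \<or> real (card (P i - A)) \<le> \<eta> * real (card (P i))"
    using expander(1) assms unfolding expander_sequence_def by blast
  obtain \<delta>2 where \<delta>2: "\<delta>2 > 0" and Q: "\<And>i A. A \<subseteq> Q i \<Longrightarrow>
        \<forall>g\<in>F. real (card (displaced (\<sigma> i g) (Q i) A)) \<le> \<delta>2 * real (card (Q i)) \<Longrightarrow>
        real (card A) \<le> \<eta> * real (card (Q i)) \<or> real (card (Q i - A)) \<le> \<eta> * real (card (Q i))"
    using expander(2) assms unfolding expander_sequence_def by blast
  \<comment> \<open>Halved, because \<open>P i\<close> and \<open>Q i\<close> have only half as many points as \<open>V i\<close>.\<close>
  define \<delta> where "\<delta> = min \<delta>1 \<delta>2 / 2"
  have \<delta>: "\<delta> > 0" "2 * \<delta> \<le> \<delta>1" "2 * \<delta> \<le> \<delta>2"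
    using \<delta>1 \<delta>2 by (auto simp: \<delta>_def)
  have "\<exists>B\<in>{{}, P i, Q i, V i}. real (card (sym_diff A B)) \<le> \<eta> * real (card (V i))"
    if A: "A \<subseteq> V i" and *: "\<forall>g\<in>F. real (card (displaced (\<sigma> i g) (V i) A)) \<le> \<delta> * real (card (V i))"
    for i A
  proof -
    define n where "n = card (P i)"
    have cP: "card (P i) = n" and cQ: "card (Q i) = n" and cV: "card (V i) = 2 * n"
      using card_eq[of i] card_V[of i] by (auto simp: n_def)
    have inv: "\<sigma> i g v \<in> P i" if "g \<in> F" "v \<in> P i" for g v
      using that invariant[of g v i] F by auto
    have inv': "\<sigma> i g v \<in> Q i" if "g \<in> F" "v \<in> Q i" for g v
      using that invariant[of g v i] permutes_in_image[OF permutes[of g i], of v] disjoint[of i] F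
      by auto
    have "real (card (displaced (\<sigma> i g) (P i) (A \<inter> P i))) \<le> \<delta>1 * n" if "g \<in> F" for g
    proof -
      have "displaced (\<sigma> i g) (P i) (A \<inter> P i) \<subseteq> displaced (\<sigma> i g) (V i) A"
        using inv that by (auto simp: displaced_def)
      then have "card (displaced (\<sigma> i g) (P i) (A \<inter> P i)) \<le> card (displaced (\<sigma> i g) (V i) A)"
        by (intro card_mono) (auto simp: displaced_def finite_P finite_Q)
      also have "real \<dots> \<le> (2 * \<delta>) * n" using * that cV by auto
      also have "\<dots> \<le> \<delta>1 * n" using \<delta> by (intro mult_right_mono) auto
      finally show ?thesis by simp
    qed
    then have p: "real (card (A \<inter> P i)) \<le> \<eta> * n \<or> real (card (P i - A)) \<le> \<eta> * n"
      using P[of "A \<inter> P i" i] cP by (simp add: Diff_Int2 Diff_Int)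
    have "real (card (displaced (\<sigma> i g) (Q i) (A \<inter> Q i))) \<le> \<delta>2 * n" if "g \<in> F" for g
    proof -
      have "displaced (\<sigma> i g) (Q i) (A \<inter> Q i) \<subseteq> displaced (\<sigma> i g) (V i) A"
        using inv' that by (auto simp: displaced_def)
      then have "card (displaced (\<sigma> i g) (Q i) (A \<inter> Q i)) \<le> card (displaced (\<sigma> i g) (V i) A)"
        by (intro card_mono) (auto simp: displaced_def finite_P finite_Q)
      also have "real \<dots> \<le> (2 * \<delta>) * n" using * that cV by auto
      also have "\<dots> \<le> \<delta>2 * n" using \<delta> by (intro mult_right_mono) auto
      finally show ?thesis by simp
    qed
    then have q: "real (card (A \<inter> Q i)) \<le> \<eta> * n \<or> real (card (Q i - A)) \<le> \<eta> * n"
      using Q[of "A \<inter> Q i" i] cQ by (simp add: Diff_Int2 Diff_Int)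
    have glue: ?thesis
      if "B \<in> {{}, P i, Q i, V i}" "sym_diff A B \<subseteq> C \<union> D"
        "real (card C) \<le> \<eta> * n" "real (card D) \<le> \<eta> * n" "C \<subseteq> V i" "D \<subseteq> V i" for B C D
    proof (rule bexI[OF _ that(1)])
      have fin: "finite C" "finite D"
        using that finite_V finite_subset by blast+
      have "card (sym_diff A B) \<le> card (C \<union> D)"
        using that fin by (intro card_mono) auto
      also have "\<dots> \<le> card C + card D" by (rule card_Un_le)
      finally show "real (card (sym_diff A B)) \<le> \<eta> * real (card (V i))"
        using that(3,4) cV by simp
    qed
    from p q show ?thesis
    proof (elim disjE)
      assume "real (card (A \<inter> P i)) \<le> \<eta> * n" "real (card (A \<inter> Q i)) \<le> \<eta> * n"
      then show ?thesis using A by (intro glue[of "{}" "A \<inter> P i" "A \<inter> Q i"]) auto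
    next
      assume "real (card (A \<inter> P i)) \<le> \<eta> * n" "real (card (Q i - A)) \<le> \<eta> * n"
      then show ?thesis using A by (intro glue[of "Q i" "A \<inter> P i" "Q i - A"]) auto
    next
      assume "real (card (P i - A)) \<le> \<eta> * n" "real (card (A \<inter> Q i)) \<le> \<eta> * n"
      then show ?thesis using A by (intro glue[of "P i" "P i - A" "A \<inter> Q i"]) auto
    next
      assume "real (card (P i - A)) \<le> \<eta> * n" "real (card (Q i - A)) \<le> \<eta> * n"
      then show ?thesis using A by (intro glue[of "V i" "P i - A" "Q i - A"]) auto
    qed
  qed
  with \<delta>(1) show ?thesis by blast
qed

end

section \<open>Sofic entropy of the fair coin and of its square\<close>

lemma sum_Pow_power_card:
  fixes s :: "'b :: comm_semiring_1"
  assumes "finite A"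
  shows "(\<Sum>D\<in>Pow A. s ^ card D) = (1 + s) ^ card A"
  using assms
proof (induction A)
  case (insert a A)
  have "(\<Sum>D\<in>Pow (insert a A). s ^ card D) = (\<Sum>D\<in>Pow A. s ^ card D) + (\<Sum>D\<in>insert a ` Pow A. s ^ card D)"
    unfolding Pow_insert by (rule sum.union_disjoint) (use insert in auto)
  also have "(\<Sum>D\<in>insert a ` Pow A. s ^ card D) = (\<Sum>D\<in>Pow A. s ^ card (insert a D))"
    by (rule sum.reindex_cong[of "insert a"]) (use insert in \<open>auto simp: inj_on_def\<close>)
  also have "\<dots> = (\<Sum>D\<in>Pow A. s * s ^ card D)"
  proof (rule sum.cong)
    fix D assume "D \<in> Pow A"
    then have "a \<notin> D" "finite D" using insert by (auto dest: finite_subset)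
    then show "s ^ card (insert a D) = s * s ^ card D" by simp
  qed simp
  finally show ?case
    using insert by (simp add: sum_distrib_left[symmetric] algebra_simps)
qed simp

text \<open>Chernoff's argument: weighing \<open>D\<close> by \<open>s ^ card D\<close> with \<open>s < 1\<close> bounds the size of a Hamming ball of
radius \<open>\<eta> n\<close> by \<open>((1 + s) s\<^sup>-\<^sup>\<eta>)\<^sup>n\<close>. Choosing first \<open>s\<close> and then \<open>\<eta>\<close> small makes both factors
contribute at most \<open>\<kappa> / 2\<close> to the exponent.\<close>

lemma hamming_ball_bound:
  assumes "\<kappa> > 0"
  shows "\<exists>\<eta>>0. \<forall>W :: 'v set. finite W \<longrightarrow>
    real (card {D \<in> Pow W. real (card D) \<le> \<eta> * real (card W)}) \<le> exp (\<kappa> * real (card W))"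
proof -
  define s where "s = min (1/2) (\<kappa> / 2)"
  define \<eta> where "\<eta> = \<kappa> / (2 * - ln s)"
  have s: "0 < s" "s < 1" "s \<le> \<kappa> / 2" using assms by (auto simp: s_def)
  have lns: "ln s < 0" using s by simp
  have \<eta>: "\<eta> > 0" "- (\<eta> * ln s) = \<kappa> / 2"
    using lns assms by (auto simp: \<eta>_def field_simps)
  have "real (card {D \<in> Pow W. real (card D) \<le> \<eta> * real (card W)}) \<le> exp (\<kappa> * real (card W))"
    if W: "finite W" for W :: "'v set"
  proof -
    let ?n = "real (card W)"
    let ?B = "{D \<in> Pow W. real (card D) \<le> \<eta> * ?n}"
    have "real (card ?B) * s powr (\<eta> * ?n) = (\<Sum>D\<in>?B. s powr (\<eta> * ?n))" by simp
    also have "\<dots> \<le> (\<Sum>D\<in>?B. s ^ card D)"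
      using s by (intro sum_mono) (auto simp: powr_realpow[symmetric] intro!: powr_mono')
    also have "\<dots> \<le> (\<Sum>D\<in>Pow W. s ^ card D)"
      by (rule sum_mono2) (use W s in auto)
    also have "\<dots> = (1 + s) ^ card W" by (rule sum_Pow_power_card[OF W])
    also have "\<dots> \<le> exp s ^ card W"
      using s by (intro power_mono exp_ge_add_one_self) auto
    also have "\<dots> = exp (s * ?n)" by (simp add: exp_of_nat2_mult)
    also have "\<dots> \<le> exp (\<kappa> / 2 * ?n)"
      using mult_right_mono[OF s(3), of ?n] by simp
    finally have "real (card ?B) \<le> exp (\<kappa> / 2 * ?n) / s powr (\<eta> * ?n)"
      using s by (simp add: field_simps)
    also have "\<dots> = exp (\<kappa> / 2 * ?n + (- (\<eta> * ln s)) * ?n)"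
      using s by (simp add: powr_def exp_diff[symmetric] algebra_simps)
    also have "\<dots> = exp (\<kappa> * ?n)"
      unfolding \<eta>(2) by simp
    finally show ?thesis .
  qed
  with \<eta>(1) show ?thesis by blast
qed

lemma sofic_entropy_le:
  assumes "\<And>\<epsilon>. \<epsilon> > 0 \<Longrightarrow> \<exists>U F \<delta>. openin (weak_star X) U \<and> \<mu> \<in> U \<and> finite F \<and> F \<subseteq> carrier G \<and> \<delta> > 0 \<and>
    limsup (\<lambda>i. normalized_log (card (V i))
      (separation_number \<epsilon> (Map X T \<rho> U F \<delta> (V i) (\<sigma> i)) \<rho> (V i))) \<le> C"
  shows "sofic_entropy G V \<sigma> X \<mu> T \<rho> \<le> C"
  unfolding sofic_entropy_def
proof (rule SUP_least)
  fix \<epsilon> :: real assume "\<epsilon> \<in> {0<..}"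
  then obtain U F \<delta> where *: "openin (weak_star X) U" "\<mu> \<in> U" "finite F" "F \<subseteq> carrier G" "\<delta> > 0"
    "limsup (\<lambda>i. normalized_log (card (V i))
      (separation_number \<epsilon> (Map X T \<rho> U F \<delta> (V i) (\<sigma> i)) \<rho> (V i))) \<le> C"
    using assms[of \<epsilon>] by auto
  show "(INF U\<in>{U. openin (weak_star X) U \<and> \<mu> \<in> U}.
        INF F\<in>{F. finite F \<and> F \<subseteq> carrier G}. INF \<delta>\<in>{0<..}.
          limsup (\<lambda>i. normalized_log (card (V i))
            (separation_number \<epsilon> (Map X T \<rho> U F \<delta> (V i) (\<sigma> i)) \<rho> (V i)))) \<le> C"
    by (rule INF_lower2[of U], use * in simp, rule INF_lower2[of F], use * in simp,
        rule INF_lower2[of \<delta>]) (use * in auto)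
qed

lemma sofic_entropy_ge:
  assumes "\<And>U F \<delta>. openin (weak_star X) U \<Longrightarrow> \<mu> \<in> U \<Longrightarrow> finite F \<Longrightarrow> F \<subseteq> carrier G \<Longrightarrow> \<delta> > 0 \<Longrightarrow>
    C \<le> limsup (\<lambda>i. normalized_log (card (V i))
      (separation_number 1 (Map X T \<rho> U F \<delta> (V i) (\<sigma> i)) \<rho> (V i)))"
  shows "C \<le> sofic_entropy G V \<sigma> X \<mu> T \<rho>"
  unfolding sofic_entropy_def
  by (rule SUP_upper2[of 1], simp, intro INF_greatest) (auto intro: assms)

lemma finite_separated_cards:
  assumes "finite M"
  shows "finite {card A | A. finite A \<and> A \<subseteq> M \<and> R A}"
  by (rule finite_subset[of _ "card ` Pow M"]) (use assms in auto)

lemma separation_number_empty: "separation_number \<epsilon> {} \<rho> V = 0"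
proof -
  have "{card A |A. finite A \<and> A \<subseteq> {} \<and> (\<forall>x\<in>A. \<forall>y\<in>A. x \<noteq> y \<longrightarrow> \<epsilon> \<le> rho_inf \<rho> V x y)} = {0}"
    by auto
  then show ?thesis by (simp add: separation_number_def)
qed

lemma separation_number_le_card:
  assumes "finite M"
  shows "separation_number \<epsilon> M \<rho> V \<le> card M"
  unfolding separation_number_def
  by (rule Max.boundedI[OF finite_separated_cards[OF assms]]) (use assms in \<open>auto intro: card_mono\<close>)

lemma separation_number_pos:
  assumes "finite M" "x \<in> M"
  shows "separation_number \<epsilon> M \<rho> V \<ge> 1"
  unfolding separation_number_def
  by (rule Max_ge[OF finite_separated_cards[OF assms(1)]])
    (use assms in \<open>auto intro!: exI[of _ "{x}"]\<close>)

lemma finite_Map_discrete: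
  assumes "finite V" "finite S"
  shows "finite (Map (discrete_topology S) T \<rho> U F \<delta> V \<sigma>)"
  by (rule finite_subset[OF _ finite_PiE[OF assms(1), of "\<lambda>_. S"]]) (use assms in \<open>auto simp: Map_def\<close>)

abbreviation fair_coin :: "real measure" where
  "fair_coin \<equiv> uniform_count_measure {0, 1}"

lemma fair_coin_Prob: "fair_coin \<in> Prob (discrete_topology {0, 1})"
  unfolding Prob_def
  by (auto simp: sets_borel_of_discrete sets_uniform_count_measure intro!: prob_space_uniform_count_measure)

lemma fair_coin_square_Prob:
  "fair_coin \<Otimes>\<^sub>M fair_coin \<in> Prob (discrete_topology ({0, 1} \<times> {0, 1}))"
proof -
  interpret prob_space fair_coin by (rule prob_space_uniform_count_measure) auto
  interpret pair_prob_space fair_coin fair_coin by standard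
  have "sets (fair_coin \<Otimes>\<^sub>M fair_coin) = sets (count_space {0, 1 :: real} \<Otimes>\<^sub>M count_space {0, 1 :: real})"
    by (intro sets_pair_measure_cong) (auto simp: sets_uniform_count_measure)
  also have "\<dots> = Pow ({0, 1} \<times> {0, 1})"
    by (subst pair_measure_count_space) auto
  finally show ?thesis
    using P.prob_space_axioms by (simp add: Prob_def sets_borel_of_discrete)
qed

lemma measure_fair_coin_square: "measure (fair_coin \<Otimes>\<^sub>M fair_coin) {(1, 1)} = 1 / 4"
proof -
  interpret coin: prob_space fair_coin by (rule prob_space_uniform_count_measure) auto
  have "emeasure (fair_coin \<Otimes>\<^sub>M fair_coin) ({1} \<times> {1}) = emeasure fair_coin {1} * emeasure fair_coin {1}"
    by (rule coin.emeasure_pair_measure_Times) (auto simp: sets_uniform_count_measure)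
  also have "\<dots> = ennreal (1 / 4)"
  proof -
    have "emeasure fair_coin {1} = ennreal (1 / 2)"
      by (subst emeasure_uniform_count_measure) auto
    then show ?thesis by (simp only: ennreal_mult[symmetric]) simp
  qed
  finally show ?thesis by (intro measure_eq_emeasure_eq_ennreal) auto
qed

context two_expanders
begin

text \<open>The set of points coloured \<open>(1, 1)\<close> would have density within \<open>1/8\<close> of \<open>1/4\<close> and within \<open>1/8\<close> of
\<open>0\<close>, \<open>1/2\<close> or \<open>1\<close>. The weak* neighbourhood gives the first estimate with strict inequality,
so there are no microstates.\<close>

lemma entropy_fair_coin_square:
  assumes "generating_pseudometric G (discrete_topology ({0, 1} \<times> {0, 1})) (trivial_action ({0, 1} \<times> {0, 1})) \<rho>"
  shows "sofic_entropy G V \<sigma> (discrete_topology ({0, 1} \<times> {0, 1})) (fair_coin \<Otimes>\<^sub>M fair_coin)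
    (trivial_action ({0, 1} \<times> {0, 1})) \<rho> = -\<infinity>"
proof -
  let ?S = "{0, 1 :: real} \<times> {0, 1 :: real}" and ?\<mu> = "fair_coin \<Otimes>\<^sub>M fair_coin"
  obtain c where c: "c > 0" "\<forall>x\<in>?S. \<forall>y\<in>?S. x \<noteq> y \<longrightarrow> c \<le> \<rho> x y"
    using generating_trivial_action_gap[OF _ assms] by auto
  obtain U where U: "openin (weak_star (discrete_topology ?S)) U" "?\<mu> \<in> U"
    and freq: "\<And>(W :: 'v set) x. finite W \<Longrightarrow> W \<noteq> {} \<Longrightarrow> x \<in> W \<rightarrow> ?S \<Longrightarrow>
       empirical_measure (discrete_topology ?S) W x \<in> U \<Longrightarrow>
       \<bar>card {v \<in> W. x v = (1, 1)} / card W - measure ?\<mu> {(1, 1)}\<bar> < 1/8"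
    using weak_star_neighbourhood_frequency[OF fair_coin_square_Prob, of "(1, 1)" "1/8", where 'v = 'v]
    by auto
  obtain \<delta> where \<delta>: "\<delta> > 0" and near: "\<And>i A. A \<subseteq> V i \<Longrightarrow>
    \<forall>g\<in>F. real (card (displaced (\<sigma> i g) (V i) A)) \<le> \<delta> * real (card (V i)) \<Longrightarrow>
    \<exists>B\<in>{{}, P i, Q i, V i}. real (card (sym_diff A B)) \<le> 1/8 * real (card (V i))"
    using nearly_invariant_sets[of "1/8"] by auto
  have empty: "Map (discrete_topology ?S) (trivial_action ?S) \<rho> U F (c * sqrt \<delta>) (V i) (\<sigma> i) = {}" for i
  proof (rule ccontr)
    assume "\<not> ?thesis"
    then obtain x where x: "x \<in> Map (discrete_topology ?S) (trivial_action ?S) \<rho> U F (c * sqrt \<delta>) (V i) (\<sigma> i)"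
      by blast
    let ?A = "{v \<in> V i. x v \<in> {(1, 1)}}"
    have "real (card (displaced (\<sigma> i g) (V i) ?A)) \<le> \<delta> * real (card (V i))" if "g \<in> F" for g
      using microstate_level_sets[where E = "{(1, 1)}", OF finite_V _ c x that permutes \<delta>] that F by auto
    then have near_A: "\<forall>g\<in>F. real (card (displaced (\<sigma> i g) (V i) ?A)) \<le> \<delta> * real (card (V i))"
      by blast
    obtain B where B: "B \<in> {{}, P i, Q i, V i}" and AB: "real (card (sym_diff ?A B)) \<le> 1/8 * real (card (V i))"
      using near[OF _ near_A] by blast
    have "\<bar>card ?A / card (V i) - 1/4\<bar> < 1/8"
      using freq[of "V i" x] finite_V nonempty x by (auto simp: Map_def measure_fair_coin_square)
    then have A: "1/8 * card (V i) < card ?A" "card ?A < 3/8 * card (V i)"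
    proof -
      let ?q = "card ?A / card (V i)"
      assume "\<bar>?q - 1/4\<bar> < 1/8"
      then have "1/8 < ?q" "?q < 3/8" by linarith+
      moreover have n: "real (card (V i)) > 0" using card_V_pos[of i] by simp
      ultimately show "1/8 * card (V i) < card ?A" "card ?A < 3/8 * card (V i)"
        by (blast intro: pos_less_divide_eq[OF n, THEN iffD1] pos_divide_less_eq[OF n, THEN iffD1])+
    qed
    have fin: "finite ?A" "finite B" using B finite_V[of i] finite_P[of i] finite_Q[of i] by auto
    have "card ?A \<le> card (sym_diff ?A B \<union> B)"
      using fin by (intro card_mono) auto
    also have "\<dots> \<le> card (sym_diff ?A B) + card B" by (rule card_Un_le)
    finally have up: "card ?A \<le> card (sym_diff ?A B) + card B" .
    have "card B \<le> card (sym_diff ?A B \<union> ?A)"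
      using fin by (intro card_mono) auto
    also have "\<dots> \<le> card (sym_diff ?A B) + card ?A" by (rule card_Un_le)
    finally have lo: "card B \<le> card (sym_diff ?A B) + card ?A" .
    have "card B = 0 \<or> 2 * card B \<ge> card (V i)"
      using B card_V[of i] card_eq[of i] by auto
    then show False
      using up lo A AB by linarith
  qed
  have "sofic_entropy G V \<sigma> (discrete_topology ?S) ?\<mu> (trivial_action ?S) \<rho> \<le> -\<infinity>"
  proof (rule sofic_entropy_le)
    fix \<epsilon> :: real assume "\<epsilon> > 0"
    have "limsup (\<lambda>i. normalized_log (card (V i))
      (separation_number \<epsilon> (Map (discrete_topology ?S) (trivial_action ?S) \<rho> U F (c * sqrt \<delta>) (V i) (\<sigma> i)) \<rho> (V i))) \<le> -\<infinity>"
      unfolding empty separation_number_empty normalized_log_def by (simp add: Limsup_const)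
    then show "\<exists>U F \<delta>. openin (weak_star (discrete_topology ?S)) U \<and> ?\<mu> \<in> U \<and> finite F \<and> F \<subseteq> carrier G \<and> \<delta> > 0 \<and>
      limsup (\<lambda>i. normalized_log (card (V i))
        (separation_number \<epsilon> (Map (discrete_topology ?S) (trivial_action ?S) \<rho> U F \<delta> (V i) (\<sigma> i)) \<rho> (V i))) \<le> -\<infinity>"
      using U F c(1) \<delta> by (intro exI[of _ U] exI[of _ F] exI[of _ "c * sqrt \<delta>"]) auto
  qed
  then show ?thesis by simp
qed

text \<open>The indicator function of \<open>P i\<close> is exactly equivariant and has empirical measure exactly the fair
coin, because \<open>P i\<close> is an invariant half of \<open>V i\<close>.\<close>

lemma entropy_fair_coin_nonneg:
  assumes "generating_pseudometric G (discrete_topology {0, 1}) (trivial_action {0, 1}) \<rho>"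
  shows "0 \<le> sofic_entropy G V \<sigma> (discrete_topology {0, 1}) fair_coin (trivial_action {0, 1}) \<rho>"
proof (rule sofic_entropy_ge)
  let ?X = "discrete_topology {0, 1 :: real}" and ?T = "trivial_action {0, 1 :: real}"
  fix U F' and \<delta> :: real
  assume *: "openin (weak_star ?X) U" "fair_coin \<in> U" "F' \<subseteq> carrier G" "\<delta> > 0"
  let ?M = "\<lambda>i. Map ?X ?T \<rho> U F' \<delta> (V i) (\<sigma> i)"
  have refl: "\<rho> a a = 0" if "a \<in> {0, 1}" for a
    using assms that unfolding generating_pseudometric_def continuous_pseudometric_def
      topspace_discrete_topology by blast
  have "0 \<le> normalized_log (card (V i)) (separation_number 1 (?M i) \<rho> (V i))" for i
  proof -
    define x where "x = (\<lambda>v\<in>V i. if v \<in> P i then 1 else 0 :: real)"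
    have x01: "x \<in> V i \<rightarrow>\<^sub>E {0, 1}" by (auto simp: x_def)
    have "rho_two \<rho> (V i) (\<lambda>v. ?T g (x v)) (\<lambda>v. x (\<sigma> i g v)) = 0" if "g \<in> F'" for g
    proof -
      have g: "g \<in> carrier G" using that * by auto
      have "\<rho> (?T g (x v)) (x (\<sigma> i g v)) = 0" if "v \<in> V i" for v
      proof -
        have "\<sigma> i g v \<in> V i" using permutes_in_image[OF permutes[OF g]] that by blast
        then have "x (\<sigma> i g v) = x v" using invariant[OF g that] that by (simp add: x_def)
        moreover have "x v \<in> {0, 1}" using x01 that by blast
        ultimately show ?thesis using refl by simp
      qed
      then show ?thesis by (simp add: rho_two_def)
    qed
    moreover have "empirical_measure ?X (V i) x = fair_coin"
    proof (rule measure_eqI_finite[of _ "{0, 1}"])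
      fix a :: real assume a: "a \<in> {0, 1}"
      have "{v \<in> V i. x v \<in> {1}} = P i" "{v \<in> V i. x v \<in> {0}} = Q i"
        using disjoint[of i] by (auto simp: x_def)
      then have "card {v \<in> V i. x v \<in> {a}} = card (P i)" using a card_eq[of i] by (metis insertE singletonD)
      then have "emeasure (empirical_measure ?X (V i) x) {a} = ennreal (card (P i) / card (V i))"
        using a x01 nonempty[of i] finite_V[of i]
        by (subst emeasure_empirical_measure) auto
      also have "real (card (P i)) / real (card (V i)) = 1 / 2"
        using card_V[of i] card_V_pos[of i] by simp
      finally show "emeasure (empirical_measure ?X (V i) x) {a} = emeasure fair_coin {a}"
        using a by (auto simp: emeasure_uniform_count_measure)
    qed (auto simp: sets_empirical_measure sets_uniform_count_measure)
    ultimately have "x \<in> ?M i"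
      using x01 * by (simp add: Map_def)
    then have "separation_number 1 (?M i) \<rho> (V i) \<ge> 1"
      by (intro separation_number_pos finite_Map_discrete finite_V) auto
    then show ?thesis by (auto simp: normalized_log_def)
  qed
  then show "0 \<le> limsup (\<lambda>i. normalized_log (card (V i)) (separation_number 1 (?M i) \<rho> (V i)))"
    by (intro le_Limsup) auto
qed

text \<open>A colouring is determined by the set of points coloured \<open>1\<close>, and that set lies in a small Hamming
ball around one of the four invariant sets.\<close>

lemma card_nearly_invariant_colourings:
  assumes gen: "generating_pseudometric G (discrete_topology {0, 1}) (trivial_action {0, 1}) \<rho>"
    and "\<kappa> > 0"
  shows "\<exists>\<delta>>0. \<forall>i U. real (card (Map (discrete_topology {0, 1 :: real}) (trivial_action {0, 1}) \<rho> U F \<delta> (V i) (\<sigma> i)))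
     \<le> 4 * exp (\<kappa> * real (card (V i)))"
proof -
  let ?X = "discrete_topology {0, 1 :: real}" and ?T = "trivial_action {0, 1 :: real}"
  obtain c where c: "c > 0" "\<forall>x\<in>{0, 1}. \<forall>y\<in>{0, 1}. x \<noteq> y \<longrightarrow> c \<le> \<rho> x y"
    using generating_trivial_action_gap[OF _ gen] by auto
  obtain \<eta> where \<eta>: "\<eta> > 0" and ball: "\<And>W :: 'v set. finite W \<Longrightarrow>
    real (card {D \<in> Pow W. real (card D) \<le> \<eta> * real (card W)}) \<le> exp (\<kappa> * real (card W))"
    using hamming_ball_bound[OF assms(2), where 'v = 'v] by auto
  obtain \<delta> where \<delta>: "\<delta> > 0" and near: "\<And>i A. A \<subseteq> V i \<Longrightarrow>
    \<forall>g\<in>F. real (card (displaced (\<sigma> i g) (V i) A)) \<le> \<delta> * real (card (V i)) \<Longrightarrow>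
    \<exists>B\<in>{{}, P i, Q i, V i}. real (card (sym_diff A B)) \<le> \<eta> * real (card (V i))"
    using nearly_invariant_sets[OF \<eta>] by auto
  have "real (card (Map ?X ?T \<rho> U F (c * sqrt \<delta>) (V i) (\<sigma> i))) \<le> 4 * exp (\<kappa> * real (card (V i)))" for i U
  proof -
    let ?M = "Map ?X ?T \<rho> U F (c * sqrt \<delta>) (V i) (\<sigma> i)"
    let ?D = "{D \<in> Pow (V i). real (card D) \<le> \<eta> * real (card (V i))}"
    let ?\<phi> = "\<lambda>x. {v \<in> V i. x v \<in> {1 :: real}}"
    have M: "?M \<subseteq> V i \<rightarrow>\<^sub>E {0, 1}" by (auto simp: Map_def)
    have inj: "inj_on ?\<phi> ?M"
    proof (rule inj_onI)
      fix x y assume xy: "x \<in> ?M" "y \<in> ?M" and eq: "?\<phi> x = ?\<phi> y"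
      have x: "x \<in> V i \<rightarrow>\<^sub>E {0, 1}" and y: "y \<in> V i \<rightarrow>\<^sub>E {0, 1}" using xy M by auto
      show "x = y"
      proof (rule PiE_ext[OF x y])
        fix v assume v: "v \<in> V i"
        then have "x v \<in> {0, 1}" "y v \<in> {0, 1}" "x v = 1 \<longleftrightarrow> y v = 1"
          using PiE_mem[OF x v] PiE_mem[OF y v] eq by auto
        then show "x v = y v" by auto
      qed
    qed
    have image: "?\<phi> ` ?M \<subseteq> (\<lambda>(B, D). sym_diff D B) ` ({{}, P i, Q i, V i} \<times> ?D)"
    proof
      fix A assume "A \<in> ?\<phi> ` ?M"
      then obtain x where x: "x \<in> ?M" and A: "A = ?\<phi> x" by auto
      have "real (card (displaced (\<sigma> i g) (V i) A)) \<le> \<delta> * real (card (V i))" if "g \<in> F" for g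
        unfolding A using microstate_level_sets[where E = "{1}", OF finite_V _ c x that permutes \<delta>] that F by auto
      then have near_A: "\<forall>g\<in>F. real (card (displaced (\<sigma> i g) (V i) A)) \<le> \<delta> * real (card (V i))"
        by blast
      have "A \<subseteq> V i" unfolding A by blast
      then obtain B where B: "B \<in> {{}, P i, Q i, V i}" "real (card (sym_diff A B)) \<le> \<eta> * real (card (V i))"
        using near[OF _ near_A] by blast
      have "sym_diff A B \<in> ?D" using B A by auto
      moreover have "A = sym_diff (sym_diff A B) B" by blast
      ultimately show "A \<in> (\<lambda>(B, D). sym_diff D B) ` ({{}, P i, Q i, V i} \<times> ?D)"
        using B(1) by (intro image_eqI[of _ _ "(B, sym_diff A B)"]) auto
    qed
    have finD: "finite ?D" using finite_V[of i] by auto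
    have "card ?M = card (?\<phi> ` ?M)" by (rule card_image[OF inj, symmetric])
    also have "\<dots> \<le> card ((\<lambda>(B, D). sym_diff D B) ` ({{}, P i, Q i, V i} \<times> ?D))"
      using image finD by (intro card_mono) auto
    also have "\<dots> \<le> card ({{}, P i, Q i, V i} \<times> ?D)"
      using finD by (intro card_image_le) auto
    also have "\<dots> = card {{}, P i, Q i, V i} * card ?D" by (rule card_cartesian_product)
    also have "\<dots> \<le> 4 * card ?D"
      by (intro mult_right_mono) (auto intro: order.trans[OF card_insert_le_m1] simp: card_insert_if)
    finally have "real (card ?M) \<le> 4 * real (card ?D)" by linarith
    then show ?thesis using ball[OF finite_V[of i]] by linarith
  qed
  moreover have "c * sqrt \<delta> > 0" using c(1) \<delta> by simp
  ultimately show ?thesis by blast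
qed

lemma entropy_fair_coin_nonpos:
  assumes gen: "generating_pseudometric G (discrete_topology {0, 1}) (trivial_action {0, 1}) \<rho>"
  shows "sofic_entropy G V \<sigma> (discrete_topology {0, 1}) fair_coin (trivial_action {0, 1}) \<rho> \<le> 0"
proof (rule ereal_le_epsilon2)
  let ?X = "discrete_topology {0, 1 :: real}" and ?T = "trivial_action {0, 1 :: real}"
  fix \<kappa> :: real assume \<kappa>: "\<kappa> > 0"
  obtain \<delta> where \<delta>: "\<delta> > 0" and count: "\<And>i U. real (card (Map ?X ?T \<rho> U F \<delta> (V i) (\<sigma> i)))
     \<le> 4 * exp (\<kappa> / 2 * real (card (V i)))"
    using card_nearly_invariant_colourings[OF gen, of "\<kappa> / 2"] \<kappa> by auto
  obtain U where U: "openin (weak_star ?X) U" "fair_coin \<in> U"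
    using weak_star_neighbourhood_frequency[OF fair_coin_Prob, of 0 1] by auto
  have big: "\<forall>\<^sub>F i in sequentially. 2 * ln 4 / \<kappa> \<le> real (card (V i))"
    using sofic filterlim_compose[OF filterlim_real_sequentially, of "\<lambda>i. card (V i)"]
    by (simp add: sofic_approximation_def filterlim_at_top)
  have "sofic_entropy G V \<sigma> ?X fair_coin ?T \<rho> \<le> ereal \<kappa>"
  proof (rule sofic_entropy_le)
    fix \<epsilon> :: real assume "\<epsilon> > 0"
    let ?N = "\<lambda>i. separation_number \<epsilon> (Map ?X ?T \<rho> U F \<delta> (V i) (\<sigma> i)) \<rho> (V i)"
    have "\<forall>\<^sub>F i in sequentially. normalized_log (card (V i)) (?N i) \<le> ereal \<kappa>"
      using big
    proof eventually_elim
      case (elim i)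
      have "ln (real (?N i)) / real (card (V i)) \<le> \<kappa>" if "?N i \<noteq> 0"
      proof -
        have "real (?N i) \<le> 4 * exp (\<kappa> / 2 * real (card (V i)))"
        proof -
          have "?N i \<le> card (Map ?X ?T \<rho> U F \<delta> (V i) (\<sigma> i))"
            by (intro separation_number_le_card finite_Map_discrete finite_V) auto
          then show ?thesis using count[of U i] by linarith
        qed
        then have "ln (real (?N i)) \<le> ln (4 * exp (\<kappa> / 2 * real (card (V i))))"
          using that by (subst ln_le_cancel_iff) auto
        also have "\<dots> = ln 4 + \<kappa> / 2 * real (card (V i))"
          by (subst ln_mult) auto
        also have "\<dots> \<le> \<kappa> * real (card (V i))"
          using elim \<kappa> by (simp add: field_simps)
        finally show ?thesis using card_V_pos[of i] by (simp add: field_simps)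
      qed
      then show ?case by (simp add: normalized_log_def)
    qed
    then have "limsup (\<lambda>i. normalized_log (card (V i)) (?N i)) \<le> ereal \<kappa>"
      by (rule Limsup_bounded)
    then show "\<exists>U F \<delta>. openin (weak_star ?X) U \<and> fair_coin \<in> U \<and> finite F \<and> F \<subseteq> carrier G \<and> \<delta> > 0 \<and>
      limsup (\<lambda>i. normalized_log (card (V i))
        (separation_number \<epsilon> (Map ?X ?T \<rho> U F \<delta> (V i) (\<sigma> i)) \<rho> (V i))) \<le> ereal \<kappa>"
      using U F \<delta> by blast
  qed
  then show "sofic_entropy G V \<sigma> ?X fair_coin ?T \<rho> \<le> 0 + ereal \<kappa>" by simp
qed

end

section \<open>Affine maps of the planes over \<open>F\<^sub>2[t]/t\<^sup>m\<close>\<close>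

text \<open>As simplification rules these facts would turn the field operations into Boolean ones.\<close>

declare add_bit_eq_xor [simp del] mult_bit_eq_and [simp del]

lemma UNIV_bit: "UNIV = {0, 1 :: bit}"
  by (auto intro: bit.exhaust)

instance bit :: finite
  by standard (rule finite_subset[of _ "{0, 1}"], auto intro: bit.exhaust)

lemma bit_poly_2 [simp]: "(2 :: bit poly) = 0"
  by (simp add: numeral_poly)

lemma bit_poly_add_self [simp]: "(p :: bit poly) + p = 0"
  using mult_2[of p] by simp

lemma bit_poly_uminus [simp]: "- (p :: bit poly) = p"
  using add_eq_0_iff[of p p] by simp

lemma bit_poly_diff [simp]: "(p :: bit poly) - q = p + q"
  by (metis bit_poly_uminus diff_conv_add_uminus)

lemma bit_poly_add_eq_0_iff: "(p :: bit poly) + q = 0 \<longleftrightarrow> p = q"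
  using add_eq_0_iff[of p q] by auto

text \<open>The representatives of the residue classes of \<open>F\<^sub>2[t]\<close> modulo \<open>t\<^sup>m\<close>.\<close>

definition polys_below :: "nat \<Rightarrow> bit poly set" where
  "polys_below m = {p. \<forall>j\<ge>m. coeff p j = 0}"

lemma polys_below_Suc: "polys_below (Suc m) = (\<lambda>(c, p). pCons c p) ` (UNIV \<times> polys_below m)"
proof
  show "polys_below (Suc m) \<subseteq> (\<lambda>(c, p). pCons c p) ` (UNIV \<times> polys_below m)"
  proof
    fix p assume p: "p \<in> polys_below (Suc m)"
    obtain c q where q: "p = pCons c q" by (rule pCons_cases)
    have "coeff q j = coeff p (Suc j)" for j by (simp add: q)
    then have "q \<in> polys_below m" using p by (simp add: polys_below_def)
    then show "p \<in> (\<lambda>(c, p). pCons c p) ` (UNIV \<times> polys_below m)" using q by force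
  qed
  show "(\<lambda>(c, p). pCons c p) ` (UNIV \<times> polys_below m) \<subseteq> polys_below (Suc m)"
    by (auto simp: polys_below_def coeff_pCons split: nat.split)
qed

lemma card_polys_below: "finite (polys_below m) \<and> card (polys_below m) = 2 ^ m"
proof (induction m)
  case 0
  have "polys_below 0 = {0}" by (auto simp: polys_below_def poly_eq_iff)
  then show ?case by simp
next
  case (Suc m)
  have "card (UNIV :: bit set) = 2" unfolding UNIV_bit by (subst card_2_iff) auto
  moreover have "inj_on (\<lambda>(c, p). pCons c p) (UNIV \<times> polys_below m)"
    by (auto simp: inj_on_def)
  ultimately show ?case
    using Suc by (simp add: polys_below_Suc card_image card_cartesian_product)
qed

lemma finite_polys_below: "finite (polys_below m)"
  using card_polys_below by blast

lemma zero_in_polys_below [simp]: "0 \<in> polys_below m"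
  by (simp add: polys_below_def)

lemma add_in_polys_below: "p \<in> polys_below m \<Longrightarrow> q \<in> polys_below m \<Longrightarrow> p + q \<in> polys_below m"
  by (simp add: polys_below_def)

lemma coeff_mod_monom: "coeff (p mod monom (1 :: bit) m) j = (if j < m then coeff p j else 0)"
proof -
  have "poly_cutoff m p = p mod monom 1 m"
  proof -
    have "p = monom 1 m * poly_shift m p + poly_cutoff m p"
      by (rule poly_eqI) (simp add: coeff_monom_mult coeff_poly_shift coeff_poly_cutoff)
    then have "p mod monom 1 m = poly_cutoff m p mod monom 1 m"
      by (metis mod_mult_self4)
    also have "\<dots> = poly_cutoff m p"
    proof (cases "m = 0")
      case True
      then have "poly_cutoff m p = 0" by (simp add: poly_eq_iff coeff_poly_cutoff)
      then show ?thesis by simp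
    next
      case False
      then have "degree (poly_cutoff m p) < m"
        by (intro degree_lessI) (auto simp: coeff_poly_cutoff)
      then show ?thesis by (intro mod_poly_less) (simp add: degree_monom_eq)
    qed
    finally show ?thesis by simp
  qed
  then show ?thesis by (metis coeff_poly_cutoff)
qed

lemma mod_in_polys_below [simp]: "p mod monom 1 m \<in> polys_below m"
  by (simp add: polys_below_def coeff_mod_monom)

lemma mod_polys_below [simp]: "p \<in> polys_below m \<Longrightarrow> p mod monom 1 m = p"
  by (rule poly_eqI) (simp add: polys_below_def coeff_mod_monom)

lemma mod_monom_eq_0_iff: "p mod monom (1 :: bit) m = 0 \<longleftrightarrow> (\<forall>j<m. coeff p j = 0)"
  by (auto simp: poly_eq_iff coeff_mod_monom)

definition plane :: "nat \<Rightarrow> (bit poly \<times> bit poly) set" where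
  "plane m = polys_below m \<times> polys_below m"

lemma finite_plane: "finite (plane m)"
  by (simp add: plane_def finite_polys_below)

lemma card_plane: "card (plane m) = 2 ^ m * 2 ^ m"
  using card_polys_below by (simp add: plane_def card_cartesian_product)

lemma add_in_plane: "z \<in> plane m \<Longrightarrow> w \<in> plane m \<Longrightarrow> z + w \<in> plane m"
  by (auto simp: plane_def add_in_polys_below)

lemma zero_in_plane: "0 \<in> plane m"
  by (simp add: plane_def zero_prod_def)

text \<open>A tuple \<open>(a, b, c, d, u, v)\<close> stands for the map with matrix rows \<open>(a, b)\<close>, \<open>(c, d)\<close> followed by the
translation by \<open>(u, v)\<close>.\<close>

type_synonym affine = "bit poly \<times> bit poly \<times> bit poly \<times> bit poly \<times> bit poly \<times> bit poly"

fun affine_map :: "nat \<Rightarrow> affine \<Rightarrow> bit poly \<times> bit poly \<Rightarrow> bit poly \<times> bit poly" where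
  "affine_map m (a, b, c, d, u, v) (x, y) =
     ((a * x + b * y + u) mod monom 1 m, (c * x + d * y + v) mod monom 1 m)"

fun det :: "affine \<Rightarrow> bit poly" where
  "det (a, b, c, d, u, v) = a * d - b * c"

fun affine_mult :: "affine \<Rightarrow> affine \<Rightarrow> affine" where
  "affine_mult (a, b, c, d, u, v) (a', b', c', d', u', v') =
     (a * a' + b * c', a * b' + b * d', c * a' + d * c', c * b' + d * d',
      a * u' + b * v' + u, c * u' + d * v' + v)"

fun affine_inv :: "affine \<Rightarrow> affine" where
  "affine_inv (a, b, c, d, u, v) = (d, - b, - c, a, b * v - d * u, c * u - a * v)"

definition affine_group :: "affine monoid" where
  "affine_group = \<lparr>carrier = {g. det g = 1}, mult = affine_mult, one = (1, 0, 0, 1, 0, 0)\<rparr>"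

lemma det_mult: "det (affine_mult g h) = det g * det h"
  by (cases g; cases h) (simp del: bit_poly_diff add: algebra_simps)

lemma affine_inv_mult: "det g = 1 \<Longrightarrow> affine_mult (affine_inv g) g = (1, 0, 0, 1, 0, 0)"
  by (cases g) (simp del: bit_poly_diff bit_poly_uminus add: algebra_simps)

lemma det_inv: "det (affine_inv g) = det g"
  by (cases g) (simp add: algebra_simps)

lemma group_affine_group: "group affine_group"
proof (rule groupI)
  fix g h k assume "g \<in> carrier affine_group" "h \<in> carrier affine_group" "k \<in> carrier affine_group"
  show "g \<otimes>\<^bsub>affine_group\<^esub> h \<otimes>\<^bsub>affine_group\<^esub> k = g \<otimes>\<^bsub>affine_group\<^esub> (h \<otimes>\<^bsub>affine_group\<^esub> k)"
    by (cases g; cases h; cases k) (simp add: affine_group_def algebra_simps)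
next
  fix g assume "g \<in> carrier affine_group"
  then show "\<exists>h\<in>carrier affine_group. h \<otimes>\<^bsub>affine_group\<^esub> g = \<one>\<^bsub>affine_group\<^esub>"
    by (intro bexI[of _ "affine_inv g"]) (auto simp: affine_group_def affine_inv_mult det_inv)
  show "\<one>\<^bsub>affine_group\<^esub> \<otimes>\<^bsub>affine_group\<^esub> g = g"
    by (cases g) (simp add: affine_group_def)
qed (auto simp: affine_group_def det_mult)

lemma affine_map_in_plane: "affine_map m g z \<in> plane m"
  by (cases g; cases z) (simp add: plane_def)

lemma affine_map_mult: "affine_map m (affine_mult g h) z = affine_map m g (affine_map m h z)"
proof -
  obtain a b c d u v where g: "g = (a, b, c, d, u, v)" by (cases g)
  obtain a' b' c' d' u' v' where h: "h = (a', b', c', d', u', v')" by (cases h)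
  obtain x y where z: "z = (x, y)" by (cases z)
  have "(a * (p mod monom 1 m) + b * (q mod monom 1 m) + u) mod monom 1 m
      = (a * p + b * q + u) mod monom 1 m" for a b u p q :: "bit poly"
    by (intro mod_add_cong mod_mult_cong) simp_all
  then show ?thesis by (simp add: g h z algebra_simps)
qed

lemma affine_map_one: "z \<in> plane m \<Longrightarrow> affine_map m (1, 0, 0, 1, 0, 0) z = z"
  by (auto simp: plane_def)

lemma affine_map_bij:
  assumes "det g = 1"
  shows "bij_betw (affine_map m g) (plane m) (plane m)"
proof -
  obtain h where "det h = 1" and hg: "affine_mult h g = (1, 0, 0, 1, 0, 0)"
    using affine_inv_mult[OF assms] det_inv assms by metis
  then have "inj_on (affine_map m g) (plane m)"
    by (intro inj_on_inverseI[of _ "affine_map m h"]) (simp add: affine_map_mult[symmetric] affine_map_one)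
  then show ?thesis
    unfolding bij_betw_def
    using endo_inj_surj[OF finite_plane, of "affine_map m g" m] affine_map_in_plane by blast
qed

section \<open>Fourier analysis on the plane\<close>

text \<open>The top coefficient is a nonzero functional on every nonzero ideal of \<open>F\<^sub>2[t]/t\<^sup>m\<close>, so this pairing
identifies the plane with its own character group. In characteristic \<open>2\<close> the characters
are real.\<close>

definition pairing :: "nat \<Rightarrow> bit poly \<times> bit poly \<Rightarrow> bit poly \<times> bit poly \<Rightarrow> bit" where
  "pairing m k z = coeff (fst k * fst z + snd k * snd z) (m - 1)"

definition walsh :: "nat \<Rightarrow> bit poly \<times> bit poly \<Rightarrow> bit poly \<times> bit poly \<Rightarrow> real" where
  "walsh m k z = (if pairing m k z = 0 then 1 else - 1)"

lemma walsh_add: "walsh m k (z + w) = walsh m k z * walsh m k w"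
proof -
  have "pairing m k (z + w) = pairing m k z + pairing m k w"
    by (simp add: pairing_def algebra_simps)
  then show ?thesis
    by (cases "pairing m k z"; cases "pairing m k w") (simp_all add: walsh_def)
qed

lemma walsh_commute: "walsh m k z = walsh m z k"
  by (simp add: walsh_def pairing_def mult.commute)

text \<open>The linear part of an affine map acts on frequencies by its transpose, and the translation part
only contributes a sign (\<open>walsh_affine_map\<close>).\<close>

fun transpose_part :: "affine \<Rightarrow> affine" where
  "transpose_part (a, b, c, d, u, v) = (a, c, b, d, 0, 0)"

fun translation_part :: "affine \<Rightarrow> bit poly \<times> bit poly" where
  "translation_part (a, b, c, d, u, v) = (u, v)"

lemma det_transpose: "det (transpose_part g) = det g"
  by (cases g) (simp add: mult.commute)

lemma coeff_mult_mod:
  assumes "m > 0"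
  shows "coeff (p * (q mod monom (1 :: bit) m)) (m - 1) = coeff (p * q) (m - 1)"
proof -
  have "coeff (p * (q mod monom 1 m)) (m - 1) = coeff ((p * (q mod monom 1 m)) mod monom 1 m) (m - 1)"
    using assms by (simp add: coeff_mod_monom)
  also have "\<dots> = coeff ((p * q) mod monom 1 m) (m - 1)" by (simp add: mod_simps)
  finally show ?thesis using assms by (simp add: coeff_mod_monom)
qed

lemma walsh_affine_map:
  assumes "m > 0"
  shows "walsh m k (affine_map m g z) = walsh m k (translation_part g) * walsh m (affine_map m (transpose_part g) k) z"
proof -
  obtain a b c d u v where g: "g = (a, b, c, d, u, v)" by (cases g)
  obtain x y where z: "z = (x, y)" by (cases z)
  obtain k1 k2 where k: "k = (k1, k2)" by (cases k)
  have 1: "pairing m k (affine_map m g z) = coeff (k1 * (a * x + b * y + u) + k2 * (c * x + d * y + v)) (m - 1)"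
    using coeff_mult_mod[OF assms] by (simp add: pairing_def g z k)
  have 2: "pairing m (affine_map m (transpose_part g) k) z = coeff ((a * k1 + c * k2) * x + (b * k1 + d * k2) * y) (m - 1)"
    using coeff_mult_mod[OF assms, of x] coeff_mult_mod[OF assms, of y]
    by (simp add: pairing_def g z k mult.commute[of _ x] mult.commute[of _ y])
  have "pairing m k (affine_map m g z) = pairing m k (translation_part g) + pairing m (affine_map m (transpose_part g) k) z"
    unfolding 1 2 by (simp add: pairing_def g k coeff_add[symmetric] algebra_simps del: coeff_add)
  then show ?thesis
    by (cases "pairing m k (translation_part g)"; cases "pairing m (affine_map m (transpose_part g) k) z")
      (simp_all add: walsh_def)
qed

text \<open>If \<open>z\<close> has a nonzero coefficient at \<open>t\<^sup>j\<close>, multiplication by \<open>t\<^bsup>m-1-j\<^esup>\<close> moves it to the top.\<close>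

lemma walsh_nondegenerate:
  assumes "z \<in> plane m" "z \<noteq> 0"
  shows "\<exists>k\<in>plane m. walsh m k z = - 1"
proof -
  obtain x y where z: "z = (x, y)" by (cases z)
  have monom: "monom 1 (m - 1 - j) \<in> polys_below m \<and> coeff (monom 1 (m - 1 - j) * p) (m - 1) = 1"
    if "p \<in> polys_below m" "coeff p j \<noteq> 0" for p j
  proof -
    have "j < m" using that by (auto simp: polys_below_def not_le[symmetric])
    then show ?thesis using that by (auto simp: polys_below_def coeff_monom_mult)
  qed
  have "x \<noteq> 0 \<or> y \<noteq> 0" using assms z by (auto simp: zero_prod_def)
  then show ?thesis
  proof
    assume "x \<noteq> 0"
    then obtain j where "coeff x j \<noteq> 0" by (auto simp: poly_eq_iff)
    then show ?thesis using monom[of x j] assms z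
      by (intro bexI[of _ "(monom 1 (m - 1 - j), 0)"]) (auto simp: walsh_def pairing_def plane_def)
  next
    assume "y \<noteq> 0"
    then obtain j where "coeff y j \<noteq> 0" by (auto simp: poly_eq_iff)
    then show ?thesis using monom[of y j] assms z
      by (intro bexI[of _ "(0, monom 1 (m - 1 - j))"]) (auto simp: walsh_def pairing_def plane_def)
  qed
qed

lemma plane_add_self [simp]: "(z :: bit poly \<times> bit poly) + z = 0"
  by (simp add: prod_eq_iff)

lemma plane_add_eq_0_iff: "(z :: bit poly \<times> bit poly) + w = 0 \<longleftrightarrow> z = w"
  by (auto simp: prod_eq_iff bit_poly_add_eq_0_iff)

text \<open>Translating by a frequency \<open>k0\<close> with \<open>walsh m k0 z = - 1\<close> changes the sign of the sum.\<close>

lemma sum_walsh: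
  assumes "z \<in> plane m"
  shows "(\<Sum>k\<in>plane m. walsh m k z) = (if z = 0 then real (card (plane m)) else 0)"
proof (cases "z = 0")
  case True
  then show ?thesis by (simp add: walsh_def pairing_def)
next
  case False
  then obtain k0 where k0: "k0 \<in> plane m" "walsh m k0 z = - 1"
    using walsh_nondegenerate[OF assms] by blast
  have "(\<Sum>k\<in>plane m. walsh m k z) = (\<Sum>k\<in>plane m. walsh m (k + k0) z)"
    by (rule sum.reindex_bij_witness[of _ "\<lambda>k. k + k0" "\<lambda>k. k + k0"])
      (use k0 in \<open>auto simp: add_in_plane add.assoc\<close>)
  also have "\<dots> = - (\<Sum>k\<in>plane m. walsh m k z)"
    using k0 by (simp add: walsh_commute[of m _ z] walsh_add sum_negf)
  finally show ?thesis using False by simp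
qed

definition walsh_transform :: "nat \<Rightarrow> (bit poly \<times> bit poly \<Rightarrow> real) \<Rightarrow> bit poly \<times> bit poly \<Rightarrow> real" where
  "walsh_transform m f k = (\<Sum>z\<in>plane m. f z * walsh m k z)"

lemma parseval:
  "(\<Sum>k\<in>plane m. (walsh_transform m f k)\<^sup>2) = real (card (plane m)) * (\<Sum>z\<in>plane m. (f z)\<^sup>2)"
proof -
  have "(\<Sum>k\<in>plane m. (walsh_transform m f k)\<^sup>2)
      = (\<Sum>k\<in>plane m. \<Sum>z\<in>plane m. \<Sum>w\<in>plane m. f z * f w * walsh m k (z + w))"
    unfolding walsh_transform_def power2_eq_square sum_product
    by (intro sum.cong refl) (simp add: walsh_add mult_ac)
  also have "\<dots> = (\<Sum>z\<in>plane m. \<Sum>k\<in>plane m. \<Sum>w\<in>plane m. f z * f w * walsh m k (z + w))"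
    by (rule sum.swap)
  also have "\<dots> = (\<Sum>z\<in>plane m. \<Sum>w\<in>plane m. \<Sum>k\<in>plane m. f z * f w * walsh m k (z + w))"
    by (intro sum.cong refl sum.swap)
  also have "\<dots> = (\<Sum>z\<in>plane m. \<Sum>w\<in>plane m. if z = w then f z * f w * real (card (plane m)) else 0)"
    by (intro sum.cong refl) (simp add: sum_distrib_left[symmetric] sum_walsh add_in_plane plane_add_eq_0_iff)
  also have "\<dots> = (\<Sum>z\<in>plane m. f z * f z * real (card (plane m)))"
    by (simp add: finite_plane)
  finally show ?thesis by (simp add: sum_distrib_left power2_eq_square mult_ac)
qed

text \<open>Shears and translations are involutions in characteristic \<open>2\<close>; assuming this here lets the change
of variables be the map itself in place of its inverse.\<close>

lemma walsh_transform_affine_map: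
  assumes "m > 0" "det g = 1" and inv: "\<And>z. z \<in> plane m \<Longrightarrow> affine_map m g (affine_map m g z) = z"
  shows "walsh_transform m (\<lambda>z. f (affine_map m g z)) k
    = walsh m k (translation_part g) * walsh_transform m f (affine_map m (transpose_part g) k)"
proof -
  have "walsh_transform m (\<lambda>z. f (affine_map m g z)) k = (\<Sum>z\<in>plane m. f z * walsh m k (affine_map m g z))"
    unfolding walsh_transform_def
    by (rule sum.reindex_bij_witness[of _ "affine_map m g" "affine_map m g"])
      (auto simp: inv affine_map_in_plane)
  then show ?thesis
    by (simp add: walsh_affine_map[OF assms(1)] walsh_transform_def sum_distrib_left mult_ac)
qed

section \<open>Expansion of the planes\<close>

definition spectral_mass :: "nat \<Rightarrow> (bit poly \<times> bit poly) set \<Rightarrow> (bit poly \<times> bit poly) set \<Rightarrow> real" where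
  "spectral_mass m A S = (\<Sum>k\<in>S. (walsh_transform m (indicator A) k)\<^sup>2)"

lemma spectral_mass_mono: "S \<subseteq> T \<Longrightarrow> T \<subseteq> plane m \<Longrightarrow> spectral_mass m A S \<le> spectral_mass m A T"
  unfolding spectral_mass_def by (rule sum_mono2) (auto intro: finite_subset[OF _ finite_plane])

lemma spectral_mass_Un: "S \<subseteq> plane m \<Longrightarrow> T \<subseteq> plane m \<Longrightarrow>
    spectral_mass m A (S \<union> T) \<le> spectral_mass m A S + spectral_mass m A T"
  unfolding spectral_mass_def
  by (subst sum.union_inter[symmetric]) (auto intro: finite_subset[OF _ finite_plane] sum_nonneg)

lemma sum_indicator_plane:
  assumes "A \<subseteq> plane m"
  shows "(\<Sum>z\<in>plane m. (indicator A z :: real)) = card A"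
proof -
  have "(\<Sum>z\<in>plane m. (indicator A z :: real)) = (\<Sum>z\<in>A. 1)"
    by (rule sum.mono_neutral_cong_right) (use assms finite_plane in auto)
  then show ?thesis by simp
qed

lemma sum_indicator_square:
  assumes "A \<subseteq> plane m"
  shows "(\<Sum>z\<in>plane m. (indicator A z :: real)\<^sup>2) = card A"
proof -
  have "(\<Sum>z\<in>plane m. (indicator A z :: real)\<^sup>2) = (\<Sum>z\<in>plane m. indicator A z)"
    by (intro sum.cong) (auto simp: indicator_def)
  also have "\<dots> = card A"
    by (rule sum_indicator_plane[OF assms])
  finally show ?thesis .
qed

lemma spectral_mass_plane:
  assumes "A \<subseteq> plane m"
  shows "spectral_mass m A (plane m) = real (card (plane m)) * real (card A)"
  using assms by (simp add: spectral_mass_def parseval sum_indicator_square)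

text \<open>By Parseval the total mass is \<open>N |A|\<close>, and frequency \<open>0\<close> carries \<open>|A|\<^sup>2\<close>.\<close>

lemma spectral_mass_nonzero:
  assumes "A \<subseteq> plane m"
  shows "spectral_mass m A (plane m - {0}) = real (card A) * real (card (plane m - A))"
proof -
  have "walsh_transform m (indicator A) 0 = (\<Sum>z\<in>plane m. indicator A z)"
    by (simp add: walsh_transform_def walsh_def pairing_def)
  also have "\<dots> = card A"
    by (rule sum_indicator_plane[OF assms])
  finally have "spectral_mass m A (plane m - {0}) = real (card (plane m)) * real (card A) - (real (card A))\<^sup>2"
    using spectral_mass_plane[OF assms]
    by (simp add: spectral_mass_def sum_diff1 finite_plane zero_in_plane)
  moreover have "card (plane m - A) = card (plane m) - card A" "card A \<le> card (plane m)"
    using assms finite_plane by (auto intro: card_Diff_subset card_mono finite_subset)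
  ultimately show ?thesis by (simp add: of_nat_diff algebra_simps power2_eq_square)
qed

lemma sum_displacement:
  "(\<Sum>z\<in>plane m. (indicator A z - indicator A (s z) :: real)\<^sup>2) = card (displaced s (plane m) A)"
proof -
  have "(\<Sum>z\<in>plane m. (indicator A z - indicator A (s z) :: real)\<^sup>2)
      = (\<Sum>z\<in>plane m. indicator (displaced s (plane m) A) z)"
    by (intro sum.cong) (auto simp: indicator_def displaced_def)
  also have "\<dots> = card (displaced s (plane m) A)"
    by (rule sum_indicator_plane) (auto simp: displaced_def)
  finally show ?thesis .
qed

lemma walsh_transform_diff:
  "walsh_transform m (\<lambda>z. f z - h z) k = walsh_transform m f k - walsh_transform m h k"
  by (simp add: walsh_transform_def sum_subtractf algebra_simps)

text \<open>Parseval for the difference of the indicator function of \<open>A\<close> and its composition with \<open>g\<close>, whose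
squared norm counts the displaced points.\<close>

lemma transform_displacement:
  assumes "m > 0" "det g = 1" "\<And>z. z \<in> plane m \<Longrightarrow> affine_map m g (affine_map m g z) = z"
  shows "(\<Sum>k\<in>plane m. (walsh_transform m (indicator A) k -
      walsh m k (translation_part g) * walsh_transform m (indicator A) (affine_map m (transpose_part g) k))\<^sup>2)
    = real (card (plane m)) * real (card (displaced (affine_map m g) (plane m) A))"
  using parseval[of m "\<lambda>z. indicator A z - indicator A (affine_map m g z)"]
  by (simp add: walsh_transform_diff sum_displacement
      walsh_transform_affine_map[OF assms, of "indicator A"])

text \<open>Near-invariance of \<open>A\<close> under a linear map makes its transform nearly invariant in \<open>L\<^sup>2\<close> under the
transposed map, hence its squared transform nearly invariant in \<open>L\<^sup>1\<close>.\<close>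

lemma spectral_mass_linear:
  assumes m: "m > 0" and g: "g = (a, b, c, d, 0, 0)" "det g = 1"
    and inv: "\<And>z. z \<in> plane m \<Longrightarrow> affine_map m g (affine_map m g z) = z"
    and A: "A \<subseteq> plane m" and s: "s > 0"
    and disp: "real (card (displaced (affine_map m g) (plane m) A)) \<le> 2 * s\<^sup>2 * real (card (plane m))"
    and S: "S \<subseteq> plane m"
  shows "spectral_mass m A S \<le> spectral_mass m A (affine_map m (transpose_part g) ` S) + 3 * s * (real (card (plane m)))\<^sup>2"
proof -
  let ?N = "real (card (plane m))" and ?f = "walsh_transform m (indicator A)"
  let ?L = "affine_map m (transpose_part g)"
  have bij: "bij_betw ?L (plane m) (plane m)"
    using affine_map_bij g(2) det_transpose by simp
  have inj: "inj_on ?L S"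
    using bij S by (auto simp: bij_betw_def intro: inj_on_subset)
  have w: "walsh m k (translation_part g) = 1" for k
    by (simp add: g walsh_def pairing_def)
  have cardA: "real (card A) \<le> ?N"
    using card_mono[OF finite_plane A] by simp
  have total: "(\<Sum>k\<in>plane m. (?f k)\<^sup>2) \<le> ?N\<^sup>2"
    using spectral_mass_plane[OF A] mult_left_mono[OF cardA, of ?N]
    by (simp add: spectral_mass_def power2_eq_square)
  have total': "(\<Sum>k\<in>plane m. (?f (?L k))\<^sup>2) \<le> ?N\<^sup>2"
    using sum.reindex_bij_betw[OF bij, of "\<lambda>k. (?f k)\<^sup>2"] total by simp
  have diff: "(\<Sum>k\<in>plane m. (?f k - ?f (?L k))\<^sup>2) \<le> 2 * s\<^sup>2 * ?N\<^sup>2"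
  proof -
    have "(\<Sum>k\<in>plane m. (?f k - ?f (?L k))\<^sup>2) = ?N * real (card (displaced (affine_map m g) (plane m) A))"
      using transform_displacement[OF m g(2) inv, of A] by (simp add: w)
    also have "\<dots> \<le> ?N * (2 * s\<^sup>2 * ?N)" by (rule mult_left_mono[OF disp]) simp
    finally show ?thesis by (simp add: power2_eq_square mult_ac)
  qed
  \<comment> \<open>Of \<open>p\<^sup>2 - q\<^sup>2 = (p - q) (p + q)\<close>, the factor \<open>p - q\<close> is small in \<open>L\<^sup>2\<close> and \<open>p + q\<close> is bounded; \<open>s\<close> balances the two.\<close>
  have AG: "p\<^sup>2 - q\<^sup>2 \<le> (p - q)\<^sup>2 / (2 * s) + s * (p\<^sup>2 + q\<^sup>2)" for p q :: real
  proof -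
    have "0 \<le> ((p - q) - s * (p + q))\<^sup>2 + s\<^sup>2 * (p - q)\<^sup>2" by simp
    then have "2 * s * (p\<^sup>2 - q\<^sup>2) \<le> (p - q)\<^sup>2 + 2 * s\<^sup>2 * (p\<^sup>2 + q\<^sup>2)"
      by (simp add: power2_eq_square algebra_simps)
    then show ?thesis using s by (simp add: field_simps power2_eq_square)
  qed
  have "spectral_mass m A S - spectral_mass m A (?L ` S) = (\<Sum>k\<in>S. (?f k)\<^sup>2 - (?f (?L k))\<^sup>2)"
    by (simp add: spectral_mass_def sum.reindex[OF inj] sum_subtractf)
  also have "\<dots> \<le> (\<Sum>k\<in>S. (?f k - ?f (?L k))\<^sup>2 / (2 * s) + s * ((?f k)\<^sup>2 + (?f (?L k))\<^sup>2))"
    by (intro sum_mono AG)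
  also have "\<dots> \<le> (\<Sum>k\<in>plane m. (?f k - ?f (?L k))\<^sup>2 / (2 * s) + s * ((?f k)\<^sup>2 + (?f (?L k))\<^sup>2))"
    using s by (intro sum_mono2 finite_plane S) auto
  also have "\<dots> = (\<Sum>k\<in>plane m. (?f k - ?f (?L k))\<^sup>2) / (2 * s)
      + s * ((\<Sum>k\<in>plane m. (?f k)\<^sup>2) + (\<Sum>k\<in>plane m. (?f (?L k))\<^sup>2))"
    by (simp add: sum.distrib sum_divide_distrib sum_distrib_left distrib_left)
  also have "\<dots> \<le> (2 * s\<^sup>2 * ?N\<^sup>2) / (2 * s) + s * (?N\<^sup>2 + ?N\<^sup>2)"
    using s by (intro add_mono divide_right_mono mult_left_mono diff total total') auto
  also have "\<dots> = 3 * s * ?N\<^sup>2"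
    using s by (simp add: power2_eq_square)
  finally show ?thesis by simp
qed

text \<open>Where the character value at \<open>(u, v)\<close> is \<open>-1\<close>, translation negates the transform, so that
near-invariance forces it to be small there.\<close>

lemma spectral_mass_translation:
  assumes m: "m > 0" and A: "A \<subseteq> plane m" and s: "0 < s" "s \<le> 1"
    and disp: "real (card (displaced (affine_map m (1, 0, 0, 1, u, v)) (plane m) A)) \<le> 2 * s\<^sup>2 * real (card (plane m))"
  shows "spectral_mass m A {k \<in> plane m. pairing m k (u, v) = 1} \<le> s * (real (card (plane m)))\<^sup>2"
proof -
  let ?N = "real (card (plane m))" and ?f = "walsh_transform m (indicator A)" and ?g = "(1, 0, 0, 1, u, v) :: affine"
  let ?S = "{k \<in> plane m. pairing m k (u, v) = 1}"
  have inv: "affine_map m ?g (affine_map m ?g z) = z" if "z \<in> plane m" for z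
    using that affine_map_one[OF that] by (simp add: affine_map_mult[symmetric])
  have "4 * spectral_mass m A ?S = (\<Sum>k\<in>?S. (?f k - walsh m k (u, v) * ?f k)\<^sup>2)"
    unfolding spectral_mass_def sum_distrib_left
    by (intro sum.cong) (auto simp: walsh_def power2_eq_square)
  also have "\<dots> \<le> (\<Sum>k\<in>plane m. (?f k - walsh m k (u, v) * ?f k)\<^sup>2)"
    by (rule sum_mono2) (auto simp: finite_plane)
  also have "\<dots> = ?N * real (card (displaced (affine_map m ?g) (plane m) A))"
    using transform_displacement[OF m _ inv, of A] by (simp add: affine_map_one)
  also have "\<dots> \<le> ?N * (2 * s\<^sup>2 * ?N)" by (rule mult_left_mono[OF disp]) simp
  also have "\<dots> = 2 * s\<^sup>2 * ?N\<^sup>2" by (simp add: power2_eq_square)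
  also have "\<dots> \<le> 2 * s * ?N\<^sup>2"
    using s by (intro mult_right_mono) (auto simp: power2_eq_square mult_left_le)
  finally have "4 * spectral_mass m A ?S \<le> 2 * (s * ?N\<^sup>2)" by simp
  moreover have "0 \<le> s * ?N\<^sup>2" using s by simp
  ultimately show ?thesis by linarith
qed

abbreviation lower_shear :: "bit poly \<Rightarrow> affine" where
  "lower_shear p \<equiv> (1, 0, p, 1, 0, 0)"

abbreviation upper_shear :: "bit poly \<Rightarrow> affine" where
  "upper_shear p \<equiv> (1, p, 0, 1, 0, 0)"

abbreviation translation :: "bit poly \<Rightarrow> bit poly \<Rightarrow> affine" where
  "translation u v \<equiv> (1, 0, 0, 1, u, v)"

text \<open>Every frequency with a nonzero coefficient in one of the two top degrees changes sign under one of the four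
translations; the shears then spread the remaining frequencies without reduction modulo \<open>t\<^sup>m\<close>.\<close>

definition generators :: "affine set" where
  "generators = {lower_shear (monom 1 1), lower_shear (monom 1 2),
     upper_shear (monom 1 1), upper_shear (monom 1 2),
     translation 1 0, translation (monom 1 1) 0, translation 0 1, translation 0 (monom 1 1)}"

lemma degree_shear:
  assumes "degree x \<le> degree y" "y \<noteq> 0" "degree y + j < m" "j > 0"
  shows "degree ((x + monom (1 :: bit) j * y) mod monom 1 m) = degree y + j"
proof -
  have "degree (monom 1 j * y) = degree y + j"
    using assms(2) by (simp add: degree_mult_eq degree_monom_eq)
  then have d: "degree (x + monom 1 j * y) = degree y + j"
    using assms by (subst degree_add_eq_right) auto
  then have "(x + monom 1 j * y) mod monom 1 m = x + monom 1 j * y"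
    using assms by (intro mod_poly_less) (simp add: degree_monom_eq)
  then show ?thesis using d by simp
qed

text \<open>The function \<open>gap\<close>, in the application a difference of degrees, separates \<open>S\<close> from its two images \<open>S1\<close>
and \<open>S2\<close> of at least nearly the same mass.\<close>

lemma spectral_mass_third:
  fixes gap :: "bit poly \<times> bit poly \<Rightarrow> int"
  assumes S: "S \<subseteq> plane m - {0}" and S1: "S1 \<subseteq> plane m" and S2: "S2 \<subseteq> plane m"
    and gap: "gap 0 = 0" "\<And>k. k \<in> S \<Longrightarrow> gap k \<le> 0" "\<And>k. k \<in> S1 \<Longrightarrow> gap k = 1" "\<And>k. k \<in> S2 \<Longrightarrow> gap k = 2"
    and le: "spectral_mass m A S \<le> spectral_mass m A S1 + r" "spectral_mass m A S \<le> spectral_mass m A S2 + r"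
  shows "3 * spectral_mass m A S \<le> spectral_mass m A (plane m - {0}) + 2 * r"
proof -
  have fin: "finite S" "finite S1" "finite S2"
    using S S1 S2 by (auto intro: finite_subset[OF _ finite_plane])
  have disj: "S \<inter> S1 = {}" "(S \<union> S1) \<inter> S2 = {}"
    using gap(2) gap(3) gap(4) by force+
  have "0 \<notin> S1" "0 \<notin> S2"
    using gap(1) gap(3)[of 0] gap(4)[of 0] by auto
  have "spectral_mass m A (S \<union> S1 \<union> S2) = spectral_mass m A S + spectral_mass m A S1 + spectral_mass m A S2"
    unfolding spectral_mass_def using fin disj by (simp add: sum.union_disjoint)
  moreover have "spectral_mass m A (S \<union> S1 \<union> S2) \<le> spectral_mass m A (plane m - {0})"
    by (rule spectral_mass_mono) (use S S1 S2 \<open>0 \<notin> S1\<close> \<open>0 \<notin> S2\<close> in auto)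
  ultimately show ?thesis using le by linarith
qed

text \<open>Frequencies outside \<open>K\<close> have a coefficient \<open>1\<close> at degree \<open>m - 1\<close> or \<open>m - 2\<close> and are handled by the
translations. The sets \<open>Ax\<close> and \<open>Ay\<close> cover \<open>K\<close>, and shearing shows that each carries at most a third
of the whole mass, up to errors; a mass that is at most two thirds of itself plus an error is of
the order of the error.\<close>

lemma plane_expansion:
  assumes m: "m \<ge> 3" and A: "A \<subseteq> plane m" and s: "0 < s" "s \<le> 1"
    and disp: "\<And>g. g \<in> generators \<Longrightarrow>
      real (card (displaced (affine_map m g) (plane m) A)) \<le> 2 * s\<^sup>2 * real (card (plane m))"
  shows "real (card A) * real (card (plane m - A)) \<le> 24 * s * (real (card (plane m)))\<^sup>2"
proof -
  let ?N = "real (card (plane m))" and ?\<nu> = "spectral_mass m A"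
  let ?bad = "\<lambda>u v. {k \<in> plane m. pairing m k (u, v) = 1}"
  have m0: "m > 0" using m by simp
  have shear_inv: "affine_map m (lower_shear p) (affine_map m (lower_shear p) z) = z"
      "affine_map m (upper_shear p) (affine_map m (upper_shear p) z) = z" if "z \<in> plane m" for p z
    using affine_map_one[OF that] by (simp_all add: affine_map_mult[symmetric])
  \<comment> \<open>The frequencies on which multiplication by \<open>t\<^sup>2\<close> causes no reduction modulo \<open>t\<^sup>m\<close>.\<close>
  define K where "K = {(x, y) \<in> plane m. degree x + 2 < m \<and> degree y + 2 < m \<and> (x, y) \<noteq> 0}"
  define Ax where "Ax = {(x, y) \<in> K. degree y \<le> degree x \<and> x \<noteq> 0}"
  define Ay where "Ay = {(x, y) \<in> K. degree x \<le> degree y \<and> y \<noteq> 0}"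
  have K: "K \<subseteq> plane m - {0}" by (auto simp: K_def)
  have "plane m - {0} \<subseteq> K \<union> (?bad 1 0 \<union> ?bad (monom 1 1) 0 \<union> ?bad 0 1 \<union> ?bad 0 (monom 1 1))"
  proof
    fix k assume k: "k \<in> plane m - {0}"
    obtain x y where xy: "k = (x, y)" by (cases k)
    have low: "degree p + 2 < m" if p: "p \<in> polys_below m" "coeff p (m - 1) = 0" "coeff (p * monom 1 1) (m - 1) = 0" for p
    proof -
      have "coeff p (m - 2) = 0"
        using p(3) m coeff_monom_mult[of 1 1 p "m - 1"] by (simp add: mult.commute numeral_2_eq_2)
      have "coeff p j = 0" if "j \<ge> m - 2" for j
      proof -
        have "j \<ge> m \<or> j = m - 1 \<or> j = m - 2" using that by linarith
        then show ?thesis using p \<open>coeff p (m - 2) = 0\<close> by (auto simp: polys_below_def)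
      qed
      then have "degree p < m - 2" using m by (intro degree_lessI) auto
      then show ?thesis by simp
    qed
    show "k \<in> K \<union> (?bad 1 0 \<union> ?bad (monom 1 1) 0 \<union> ?bad 0 1 \<union> ?bad 0 (monom 1 1))"
    proof (rule ccontr)
      assume "\<not> ?thesis"
      then have "coeff x (m - 1) = 0" "coeff (x * monom 1 1) (m - 1) = 0"
        "coeff y (m - 1) = 0" "coeff (y * monom 1 1) (m - 1) = 0" "k \<notin> K"
        using k xy by (auto simp: pairing_def)
      moreover have "x \<in> polys_below m" "y \<in> polys_below m" using k xy by (auto simp: plane_def)
      ultimately show False using low[of x] low[of y] k xy by (auto simp: K_def)
    qed
  qed
  then have "?\<nu> (plane m - {0}) \<le> ?\<nu> (K \<union> (?bad 1 0 \<union> ?bad (monom 1 1) 0 \<union> ?bad 0 1 \<union> ?bad 0 (monom 1 1)))"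
    by (rule spectral_mass_mono) (use K in auto)
  also have "\<dots> \<le> ?\<nu> K + (?\<nu> (?bad 1 0) + ?\<nu> (?bad (monom 1 1) 0) + ?\<nu> (?bad 0 1) + ?\<nu> (?bad 0 (monom 1 1)))"
    using K by (intro order.trans[OF spectral_mass_Un] add_mono order.refl) auto
  also have "\<dots> \<le> ?\<nu> K + (s * ?N\<^sup>2 + s * ?N\<^sup>2 + s * ?N\<^sup>2 + s * ?N\<^sup>2)"
    by (intro add_mono order.refl spectral_mass_translation m0 A s disp) (auto simp: generators_def)
  also have "?\<nu> K \<le> ?\<nu> Ax + ?\<nu> Ay"
  proof -
    have "K \<subseteq> Ax \<union> Ay" by (auto simp: Ax_def Ay_def K_def zero_prod_def)
    then have "?\<nu> K \<le> ?\<nu> (Ax \<union> Ay)"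
      by (rule spectral_mass_mono) (use K in \<open>auto simp: Ax_def Ay_def\<close>)
    also have "\<dots> \<le> ?\<nu> Ax + ?\<nu> Ay"
      by (rule spectral_mass_Un) (use K in \<open>auto simp: Ax_def Ay_def\<close>)
    finally show ?thesis .
  qed
  finally have total: "?\<nu> (plane m - {0}) \<le> ?\<nu> Ax + ?\<nu> Ay + 4 * (s * ?N\<^sup>2)" by simp
  have y: "3 * ?\<nu> Ay \<le> ?\<nu> (plane m - {0}) + 2 * (3 * s * ?N\<^sup>2)"
  proof (rule spectral_mass_third[where gap = "\<lambda>k. int (degree (fst k)) - int (degree (snd k))"])
    let ?S = "\<lambda>j. affine_map m (transpose_part (lower_shear (monom 1 j))) ` Ay"
    have deg: "degree (fst k) = degree (snd k) + j" if "k \<in> ?S j" "0 < j" "j \<le> 2" for k j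
      using that degree_shear[of _ _ j m]
      by (auto simp: Ay_def K_def plane_def mult.commute add.commute)
    show "int (degree (fst k)) - int (degree (snd k)) = 1" if "k \<in> ?S 1" for k
      using deg[OF that] by simp
    show "int (degree (fst k)) - int (degree (snd k)) = 2" if "k \<in> ?S 2" for k
      using deg[OF that] by simp
    show "int (degree (fst k)) - int (degree (snd k)) \<le> 0" if "k \<in> Ay" for k
      using that by (auto simp: Ay_def)
    show "?S 1 \<subseteq> plane m" "?S 2 \<subseteq> plane m" using affine_map_in_plane by blast+
    show "Ay \<subseteq> plane m - {0}" using K by (auto simp: Ay_def)
    then have sub: "Ay \<subseteq> plane m" by blast
    show "?\<nu> Ay \<le> ?\<nu> (?S 1) + 3 * s * ?N\<^sup>2" "?\<nu> Ay \<le> ?\<nu> (?S 2) + 3 * s * ?N\<^sup>2"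
      by (rule spectral_mass_linear[OF m0 refl _ shear_inv(1) A s(1) disp sub]; simp add: generators_def)+
  qed simp
  have x: "3 * ?\<nu> Ax \<le> ?\<nu> (plane m - {0}) + 2 * (3 * s * ?N\<^sup>2)"
  proof (rule spectral_mass_third[where gap = "\<lambda>k. int (degree (snd k)) - int (degree (fst k))"])
    let ?S = "\<lambda>j. affine_map m (transpose_part (upper_shear (monom 1 j))) ` Ax"
    have deg: "degree (snd k) = degree (fst k) + j" if "k \<in> ?S j" "0 < j" "j \<le> 2" for k j
      using that degree_shear[of _ _ j m]
      by (auto simp: Ax_def K_def plane_def mult.commute add.commute)
    show "int (degree (snd k)) - int (degree (fst k)) = 1" if "k \<in> ?S 1" for k
      using deg[OF that] by simp
    show "int (degree (snd k)) - int (degree (fst k)) = 2" if "k \<in> ?S 2" for k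
      using deg[OF that] by simp
    show "int (degree (snd k)) - int (degree (fst k)) \<le> 0" if "k \<in> Ax" for k
      using that by (auto simp: Ax_def)
    show "?S 1 \<subseteq> plane m" "?S 2 \<subseteq> plane m" using affine_map_in_plane by blast+
    show "Ax \<subseteq> plane m - {0}" using K by (auto simp: Ax_def)
    then have sub: "Ax \<subseteq> plane m" by blast
    show "?\<nu> Ax \<le> ?\<nu> (?S 1) + 3 * s * ?N\<^sup>2" "?\<nu> Ax \<le> ?\<nu> (?S 2) + 3 * s * ?N\<^sup>2"
      by (rule spectral_mass_linear[OF m0 refl _ shear_inv(2) A s(1) disp sub]; simp add: generators_def)+
  qed simp
  from total x y have "?\<nu> (plane m - {0}) \<le> 24 * (s * ?N\<^sup>2)" by linarith
  then show ?thesis by (simp add: spectral_mass_nonzero[OF A])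
qed

lemma plane_expander_sequence:
  "expander_sequence generators (\<lambda>i. plane (i + 3)) (\<lambda>i. affine_map (i + 3))"
  unfolding expander_sequence_def
proof (intro allI impI)
  fix \<eta> :: real assume \<eta>: "\<eta> > 0"
  define s where "s = min 1 (\<eta> / 48)"
  have s: "0 < s" "s \<le> 1" "48 * s \<le> \<eta>" using \<eta> by (auto simp: s_def)
  have "real (card A) \<le> \<eta> * real (card (plane m)) \<or> real (card (plane m - A)) \<le> \<eta> * real (card (plane m))"
    if m: "m \<ge> 3" and A: "A \<subseteq> plane m"
      and disp: "\<forall>g\<in>generators. real (card (displaced (affine_map m g) (plane m) A)) \<le> 2 * s\<^sup>2 * real (card (plane m))"
    for m A
  proof (rule ccontr)
    assume neg: "\<not> ?thesis"
    let ?N = "real (card (plane m))" and ?a = "real (card A)" and ?b = "real (card (plane m - A))"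
    have N: "?N > 0" by (simp add: card_plane)
    have ab: "?a + ?b = ?N"
      using card_Diff_subset[OF finite_subset[OF A finite_plane] A] card_mono[OF finite_plane A] by simp
    \<comment> \<open>One of the two parts has at least \<open>N / 2\<close> points, the other one more than \<open>\<eta> N \<ge> 48 s N\<close>.\<close>
    have "?a * ?b > 24 * s * ?N\<^sup>2"
    proof (cases "?a \<ge> ?N / 2")
      case True
      have "24 * s * ?N\<^sup>2 = ?N / 2 * (48 * s * ?N)" by (simp add: power2_eq_square)
      also have "\<dots> \<le> ?N / 2 * (\<eta> * ?N)" using s N by (intro mult_left_mono mult_right_mono) auto
      also have "\<dots> < ?N / 2 * ?b" using neg N by (intro mult_strict_left_mono) auto
      also have "\<dots> \<le> ?a * ?b" using True by (intro mult_right_mono) auto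
      finally show ?thesis .
    next
      case False
      then have b: "?b \<ge> ?N / 2" using ab by linarith
      have "24 * s * ?N\<^sup>2 = 48 * s * ?N * (?N / 2)" by (simp add: power2_eq_square)
      also have "\<dots> \<le> \<eta> * ?N * (?N / 2)" using s N by (intro mult_right_mono) auto
      also have "\<dots> < ?a * (?N / 2)" using neg N by (intro mult_strict_right_mono) auto
      also have "\<dots> \<le> ?a * ?b" using b by (intro mult_left_mono) auto
      finally show ?thesis .
    qed
    then show False
      using plane_expansion[OF m A s(1,2)] disp by force
  qed
  moreover have "2 * s\<^sup>2 > 0" using s by simp
  ultimately show "\<exists>\<delta>>0. \<forall>i. \<forall>A\<subseteq>plane (i + 3).
      (\<forall>g\<in>generators. real (card (displaced (affine_map (i + 3) g) (plane (i + 3)) A)) \<le> \<delta> * real (card (plane (i + 3)))) \<longrightarrow>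
      real (card A) \<le> \<eta> * real (card (plane (i + 3))) \<or> real (card (plane (i + 3) - A)) \<le> \<eta> * real (card (plane (i + 3)))"
    by (intro exI[of _ "2 * s\<^sup>2"]) simp
qed

section \<open>Fixed points of affine maps\<close>

text \<open>For fixed \<open>y\<close> two solutions differ by an element \<open>d\<close> with \<open>t\<^sup>m\<close> dividing \<open>\<alpha> d\<close>, so they agree below degree
\<open>m - ord \<alpha>\<close>, and a solution is determined by its \<open>ord \<alpha>\<close> top coefficients.\<close>

lemma card_linear_congruence:
  assumes "\<alpha> \<noteq> (0 :: bit poly)"
  shows "card {(x, y) \<in> plane m. (\<alpha> * x + \<beta> * y + u) mod monom 1 m = 0} \<le> 2 ^ Polynomial.order 0 \<alpha> * 2 ^ m"
proof -
  define j where "j = m - Polynomial.order 0 \<alpha>"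
  let ?S = "{(x, y) \<in> plane m. (\<alpha> * x + \<beta> * y + u) mod monom 1 m = 0}"
  have "inj_on (\<lambda>(x, y). (poly_shift j x, y)) ?S"
  proof (rule inj_onI)
    fix z z' assume z: "z \<in> ?S" "z' \<in> ?S"
      and eq: "(\<lambda>(x, y). (poly_shift j x, y)) z = (\<lambda>(x, y). (poly_shift j x, y)) z'"
    obtain x y x' where xy: "z = (x, y)" "z' = (x', y)" using eq by (cases z; cases z') auto
    have 0: "(\<alpha> * x + \<beta> * y + u) mod monom 1 m = 0" "(\<alpha> * x' + \<beta> * y + u) mod monom 1 m = 0"
      and shift: "poly_shift j x = poly_shift j x'"
      using z eq by (simp_all add: xy)
    have "(\<alpha> * x + \<beta> * y + u + (\<alpha> * x' + \<beta> * y + u)) mod monom 1 m = 0"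
      using 0 by (metis add_0 mod_0 mod_add_eq)
    moreover have "\<alpha> * x + \<beta> * y + u + (\<alpha> * x' + \<beta> * y + u)
        = \<alpha> * (x + x') + (\<beta> * y + \<beta> * y) + (u + u)"
      by (simp only: algebra_simps)
    ultimately have "[:- 0, 1:] ^ m dvd \<alpha> * (x + x')"
      by (simp add: mod_eq_0_iff_dvd monom_altdef)
    then have "\<alpha> * (x + x') = 0 \<or> m \<le> Polynomial.order 0 (\<alpha> * (x + x'))"
      by (simp only: Polynomial.order_divides)
    then have "x + x' = 0 \<or> j \<le> Polynomial.order 0 (x + x')"
      using assms Polynomial.order_mult[of \<alpha> "x + x'" 0] by (cases "x + x' = 0") (auto simp: j_def)
    then have "[:- 0, 1:] ^ j dvd x + x'"
      by (simp only: Polynomial.order_divides)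
    then have "(x + x') mod monom 1 j = 0"
      by (simp add: monom_altdef mod_eq_0_iff_dvd)
    then have low: "coeff (x + x') i = 0" if "i < j" for i
      using that by (simp only: mod_monom_eq_0_iff)
    have high: "coeff (x + x') i = 0" if "i \<ge> j" for i
      using arg_cong[OF shift, of "\<lambda>p. coeff p (i - j)"] that by (simp add: coeff_poly_shift)
    have "x + x' = 0"
      by (rule poly_eqI) (metis low high not_le coeff_0)
    then show "z = z'" by (simp add: xy bit_poly_add_eq_0_iff)
  qed
  moreover have "(\<lambda>(x, y). (poly_shift j x, y)) ` ?S \<subseteq> polys_below (Polynomial.order 0 \<alpha>) \<times> polys_below m"
    by (auto simp: plane_def polys_below_def coeff_poly_shift j_def)
  ultimately have "card ?S \<le> card (polys_below (Polynomial.order 0 \<alpha>) \<times> polys_below m)"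
    by (intro card_inj_on_le[of "\<lambda>(x, y). (poly_shift j x, y)"]) (auto simp: finite_polys_below)
  also have "\<dots> = 2 ^ Polynomial.order 0 \<alpha> * 2 ^ m"
    using card_polys_below by (simp add: card_cartesian_product)
  finally show ?thesis .
qed

lemma card_linear_congruence_either:
  assumes "\<alpha> \<noteq> 0 \<or> \<beta> \<noteq> (0 :: bit poly)"
  shows "\<exists>C. \<forall>m. card {(x, y) \<in> plane m. (\<alpha> * x + \<beta> * y + u) mod monom 1 m = 0} \<le> C * 2 ^ m"
  using assms
proof
  assume "\<alpha> \<noteq> 0"
  then show ?thesis using card_linear_congruence[of \<alpha>] by blast
next
  assume \<beta>: "\<beta> \<noteq> 0"
  have "card {(x, y) \<in> plane m. (\<alpha> * x + \<beta> * y + u) mod monom 1 m = 0} \<le> 2 ^ Polynomial.order 0 \<beta> * 2 ^ m" for m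
  proof -
    have "{(x, y) \<in> plane m. (\<alpha> * x + \<beta> * y + u) mod monom 1 m = 0}
        = prod.swap ` {(x, y) \<in> plane m. (\<beta> * x + \<alpha> * y + u) mod monom 1 m = 0}"
      by (auto simp: image_iff plane_def add.commute)
    then have "card {(x, y) \<in> plane m. (\<alpha> * x + \<beta> * y + u) mod monom 1 m = 0}
        = card {(x, y) \<in> plane m. (\<beta> * x + \<alpha> * y + u) mod monom 1 m = 0}"
      by (simp add: card_image)
    then show ?thesis using card_linear_congruence[OF \<beta>] by simp
  qed
  then show ?thesis by blast
qed

text \<open>A fixed point solves two linear congruences, with coefficients \<open>a - 1, b\<close> and \<open>c, d - 1\<close>. Either one of these
coefficients is nonzero, which leaves \<open>O(2\<^sup>m)\<close> of the \<open>4\<^sup>m\<close> points, or the map is a translation, which has no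
fixed points once \<open>m\<close> exceeds the degrees of \<open>u\<close> and \<open>v\<close>.\<close>

lemma eventually_few_fixed_points:
  assumes "g \<noteq> (1, 0, 0, 1, 0, 0)"
  shows "\<exists>C. \<forall>\<^sub>F m in sequentially. card {z \<in> plane m. affine_map m g z = z} \<le> C * 2 ^ m"
proof -
  obtain a b c d u v where g: "g = (a, b, c, d, u, v)" by (cases g)
  have fixed: "((a + 1) * x + b * y + u) mod monom 1 m = 0 \<and> (c * x + (d + 1) * y + v) mod monom 1 m = 0"
    if "(x, y) \<in> plane m" "affine_map m g (x, y) = (x, y)" for x y m
  proof -
    have "(p + q) mod monom 1 m = 0" if "p mod monom 1 m = q" "q \<in> polys_below m" for p q :: "bit poly"
      using that by (simp add: poly_mod_add_left)
    from this[of "a * x + b * y + u" x] this[of "c * x + d * y + v" y] that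
    show ?thesis by (simp add: g plane_def algebra_simps)
  qed
  consider "a + 1 \<noteq> 0 \<or> b \<noteq> 0" | "c \<noteq> 0 \<or> d + 1 \<noteq> 0" | "a = 1" "b = 0" "c = 0" "d = 1" "(u, v) \<noteq> (0, 0)"
    using assms by (auto simp: g bit_poly_add_eq_0_iff)
  then show ?thesis
  proof cases
    case 1
    then obtain C where C: "\<And>m. card {(x, y) \<in> plane m. ((a + 1) * x + b * y + u) mod monom 1 m = 0} \<le> C * 2 ^ m"
      using card_linear_congruence_either by blast
    have "card {z \<in> plane m. affine_map m g z = z} \<le> C * 2 ^ m" for m
    proof (rule order.trans[OF card_mono C])
      show "finite {(x, y) \<in> plane m. ((a + 1) * x + b * y + u) mod monom 1 m = 0}"
        by (rule finite_subset[OF _ finite_plane[of m]]) blast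
      show "{z \<in> plane m. affine_map m g z = z} \<subseteq> {(x, y) \<in> plane m. ((a + 1) * x + b * y + u) mod monom 1 m = 0}"
        using fixed by blast
    qed
    then show ?thesis by (blast intro: always_eventually)
  next
    case 2
    then obtain C where C: "\<And>m. card {(x, y) \<in> plane m. (c * x + (d + 1) * y + v) mod monom 1 m = 0} \<le> C * 2 ^ m"
      using card_linear_congruence_either by blast
    have "card {z \<in> plane m. affine_map m g z = z} \<le> C * 2 ^ m" for m
    proof (rule order.trans[OF card_mono C])
      show "finite {(x, y) \<in> plane m. (c * x + (d + 1) * y + v) mod monom 1 m = 0}"
        by (rule finite_subset[OF _ finite_plane[of m]]) blast
      show "{z \<in> plane m. affine_map m g z = z} \<subseteq> {(x, y) \<in> plane m. (c * x + (d + 1) * y + v) mod monom 1 m = 0}"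
        using fixed by blast
    qed
    then show ?thesis by (blast intro: always_eventually)
  next
    case 3
    have "\<forall>\<^sub>F m in sequentially. m > max (degree u) (degree v)" by (rule eventually_gt_at_top)
    then have "\<forall>\<^sub>F m in sequentially. card {z \<in> plane m. affine_map m g z = z} \<le> 0 * 2 ^ m"
    proof eventually_elim
      case (elim m)
      then have uv: "u mod monom 1 m = u" "v mod monom 1 m = v"
        by (auto intro!: mod_poly_less simp: degree_monom_eq)
      have "affine_map m g z \<noteq> z" if z: "z \<in> plane m" for z
      proof
        assume "affine_map m g z = z"
        then have "u mod monom 1 m = 0 \<and> v mod monom 1 m = 0"
          using fixed[of "fst z" "snd z" m] z 3(1-4) by simp
        then show False using 3(5) uv by simp
      qed
      then have "{z \<in> plane m. affine_map m g z = z} = {}" by blast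
      then show ?case by (simp only: card.empty)
    qed
    then show ?thesis by blast
  qed
qed

lemma fixed_point_ratio:
  assumes "g \<noteq> (1, 0, 0, 1, 0, 0)"
  shows "(\<lambda>i. real (card {z \<in> plane (i + 3). affine_map (i + 3) g z = z}) / real (card (plane (i + 3)))) \<longlonglongrightarrow> 0"
proof -
  obtain C where C: "\<forall>\<^sub>F m in sequentially. card {z \<in> plane m. affine_map m g z = z} \<le> C * 2 ^ m"
    using eventually_few_fixed_points[OF assms] by blast
  have "(\<lambda>m. real (card {z \<in> plane m. affine_map m g z = z}) / real (card (plane m))) \<longlonglongrightarrow> 0"
  proof (rule tendsto_sandwich[OF _ _ tendsto_const])
    show "\<forall>\<^sub>F m in sequentially. real (card {z \<in> plane m. affine_map m g z = z}) / real (card (plane m)) \<le> real C * (1 / 2) ^ m"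
      using C
    proof eventually_elim
      case (elim m)
      then have "real (card {z \<in> plane m. affine_map m g z = z}) \<le> real (C * 2 ^ m)"
        by (simp only: of_nat_le_iff)
      then show ?case by (simp add: card_plane field_simps power_one_over)
    qed
    show "(\<lambda>m. real C * (1 / 2) ^ m) \<longlonglongrightarrow> 0"
      by (intro tendsto_mult_right_zero LIMSEQ_power_zero) simp
  qed auto
  then show ?thesis by (rule LIMSEQ_ignore_initial_segment)
qed

section \<open>Two numbered copies of an expanding action\<close>

instance poly :: ("{zero, countable}") countable
  by (rule countable_classI[of "\<lambda>p. to_nat (coeffs p)"]) (simp add: coeffs_eq_iff)

definition nat_copy :: "('a :: countable) monoid \<Rightarrow> nat monoid" where
  "nat_copy G = \<lparr>carrier = to_nat ` carrier G,
     mult = (\<lambda>x y. to_nat (from_nat x \<otimes>\<^bsub>G\<^esub> from_nat y)), one = to_nat \<one>\<^bsub>G\<^esub>\<rparr>"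

lemma group_nat_copy:
  assumes "group G"
  shows "group (nat_copy G)"
proof -
  interpret group G by fact
  show ?thesis
  proof (rule groupI)
    fix x assume "x \<in> carrier (nat_copy G)"
    then obtain g where "x = to_nat g" "g \<in> carrier G" by (auto simp: nat_copy_def)
    then show "\<exists>y\<in>carrier (nat_copy G). y \<otimes>\<^bsub>nat_copy G\<^esub> x = \<one>\<^bsub>nat_copy G\<^esub>"
      by (intro bexI[of _ "to_nat (inv\<^bsub>G\<^esub> g)"]) (auto simp: nat_copy_def)
  qed (auto simp: nat_copy_def m_assoc)
qed

text \<open>An honest action whose finite pieces \<open>W i\<close> expand. Two disjoint copies of it, with points and group
elements encoded as natural numbers, satisfy \<open>two_expanders\<close>.\<close>

locale expanding_action =
  fixes G :: "('g :: countable) monoid" and F :: "'g set" and W :: "nat \<Rightarrow> ('w :: countable) set"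
    and act :: "nat \<Rightarrow> 'g \<Rightarrow> 'w \<Rightarrow> 'w"
  assumes group: "group G" and F: "finite F" "F \<subseteq> carrier G"
    and finite_W: "finite (W i)" and W_nonempty: "W i \<noteq> {}"
    and card_W: "filterlim (\<lambda>i. card (W i)) at_top sequentially"
    and act_bij: "g \<in> carrier G \<Longrightarrow> bij_betw (act i g) (W i) (W i)"
    and act_mult: "g \<in> carrier G \<Longrightarrow> h \<in> carrier G \<Longrightarrow> w \<in> W i \<Longrightarrow>
      act i (g \<otimes>\<^bsub>G\<^esub> h) w = act i g (act i h w)"
    and fixed_points: "g \<in> carrier G \<Longrightarrow> g \<noteq> \<one>\<^bsub>G\<^esub> \<Longrightarrow>
      (\<lambda>i. real (card {w \<in> W i. act i g w = w}) / real (card (W i))) \<longlonglongrightarrow> 0"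
    and expander: "expander_sequence F W act"
begin

definition copy :: "bool \<Rightarrow> nat \<Rightarrow> nat set" where
  "copy b i = (\<lambda>w. to_nat (b, w)) ` W i"

definition double_act :: "nat \<Rightarrow> nat \<Rightarrow> nat \<Rightarrow> nat" where
  "double_act i g n = (if n \<in> copy True i \<union> copy False i
     then (case from_nat n of (b, w) \<Rightarrow> to_nat (b :: bool, act i (from_nat g) w)) else n)"

lemma double_act_copy:
  "w \<in> W i \<Longrightarrow> double_act i (to_nat g) (to_nat (b :: bool, w)) = to_nat (b, act i g w)"
  by (cases b) (auto simp: double_act_def copy_def)

lemma inj_copy: "inj_on (\<lambda>w. to_nat (b :: bool, w)) S"
  by (auto simp: inj_on_def)

lemma act_in: "g \<in> carrier G \<Longrightarrow> w \<in> W i \<Longrightarrow> act i g w \<in> W i"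
  using act_bij by (auto simp: bij_betw_def)

lemma card_copy: "card (copy b i) = card (W i)"
  by (simp add: copy_def card_image inj_copy)

lemma finite_copy: "finite (copy b i)"
  by (simp add: copy_def finite_W)

lemma disjoint_copies: "copy True i \<inter> copy False i = {}"
  by (auto simp: copy_def)

lemma double_act_image:
  assumes "g \<in> carrier G"
  shows "double_act i (to_nat g) ` copy b i = copy b i"
proof -
  have "double_act i (to_nat g) ` copy b i = (\<lambda>w. to_nat (b, act i g w)) ` W i"
    unfolding copy_def image_image by (intro image_cong refl) (simp add: double_act_copy)
  also have "\<dots> = (\<lambda>w. to_nat (b, w)) ` act i g ` W i" by (simp add: image_image)
  finally show ?thesis using act_bij[OF assms] by (simp add: bij_betw_def copy_def)
qed

lemma double_act_permutes:
  assumes "g \<in> carrier G"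
  shows "double_act i (to_nat g) permutes copy True i \<union> copy False i"
proof (rule bij_imp_permutes)
  have "double_act i (to_nat g) ` (copy True i \<union> copy False i) = copy True i \<union> copy False i"
    by (simp add: image_Un double_act_image assms)
  then show "bij_betw (double_act i (to_nat g)) (copy True i \<union> copy False i) (copy True i \<union> copy False i)"
    by (simp add: bij_betw_def eq_card_imp_inj_on finite_copy)
qed (simp add: double_act_def)

lemma card_copies: "card {n \<in> copy True i \<union> copy False i. R n}
    = card {w \<in> W i. R (to_nat (True, w))} + card {w \<in> W i. R (to_nat (False, w))}"
proof -
  have 1: "{n \<in> copy b i. R n} = (\<lambda>w. to_nat (b, w)) ` {w \<in> W i. R (to_nat (b, w))}" for b
    by (auto simp: copy_def)
  have "{n \<in> copy True i \<union> copy False i. R n} = {n \<in> copy True i. R n} \<union> {n \<in> copy False i. R n}"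
    by auto
  then have "card {n \<in> copy True i \<union> copy False i. R n} = card {n \<in> copy True i. R n} + card {n \<in> copy False i. R n}"
    using disjoint_copies[of i] by (simp, subst card_Un_disjoint) (auto simp: finite_copy)
  then show ?thesis by (simp add: 1 card_image inj_copy)
qed

lemma card_both_copies: "card (copy True i \<union> copy False i) = 2 * card (W i)"
  using card_Un_disjoint[OF finite_copy finite_copy disjoint_copies] by (simp add: card_copy)

lemma expander_copy: "expander_sequence (to_nat ` F) (copy b) double_act"
  unfolding expander_sequence_def
proof (intro allI impI)
  fix \<eta> :: real assume "\<eta> > 0"
  then obtain \<delta> where \<delta>: "\<delta> > 0" and exp: "\<And>i A. A \<subseteq> W i \<Longrightarrow>
        \<forall>g\<in>F. real (card (displaced (act i g) (W i) A)) \<le> \<delta> * real (card (W i)) \<Longrightarrow>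
        real (card A) \<le> \<eta> * real (card (W i)) \<or> real (card (W i - A)) \<le> \<eta> * real (card (W i))"
    using expander unfolding expander_sequence_def by blast
  have "real (card A) \<le> \<eta> * real (card (copy b i)) \<or> real (card (copy b i - A)) \<le> \<eta> * real (card (copy b i))"
    if A: "A \<subseteq> copy b i"
      and disp: "\<forall>g\<in>to_nat ` F. real (card (displaced (double_act i g) (copy b i) A)) \<le> \<delta> * real (card (copy b i))"
    for i A
  proof -
    let ?e = "\<lambda>w. to_nat (b, w)"
    define A' where "A' = {w \<in> W i. ?e w \<in> A}"
    have "displaced (double_act i (to_nat g)) (copy b i) A = ?e ` displaced (act i g) (W i) A'" if "g \<in> F" for g
      using that F(2) act_in by (auto simp: displaced_def copy_def A'_def double_act_copy)
    then have "\<forall>g\<in>F. real (card (displaced (act i g) (W i) A')) \<le> \<delta> * real (card (W i))"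
      using disp by (simp add: card_image inj_copy card_copy)
    then have "real (card A') \<le> \<eta> * real (card (W i)) \<or> real (card (W i - A')) \<le> \<eta> * real (card (W i))"
      by (intro exp) (auto simp: A'_def)
    moreover have "A = ?e ` A'" "copy b i - A = ?e ` (W i - A')"
      using A by (auto simp: copy_def A'_def)
    ultimately show ?thesis by (simp add: card_image inj_copy card_copy)
  qed
  with \<delta> show "\<exists>\<delta>>0. \<forall>i. \<forall>A\<subseteq>copy b i.
        (\<forall>g\<in>to_nat ` F. real (card (displaced (double_act i g) (copy b i) A)) \<le> \<delta> * real (card (copy b i))) \<longrightarrow>
        real (card A) \<le> \<eta> * real (card (copy b i)) \<or> real (card (copy b i - A)) \<le> \<eta> * real (card (copy b i))"
    by blast
qed

lemma sofic_double_act: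
  "sofic_approximation (nat_copy G) (\<lambda>i. copy True i \<union> copy False i) double_act"
  unfolding sofic_approximation_def
proof (intro conjI ballI allI impI)
  show "finite (copy True i \<union> copy False i)" for i by (simp add: finite_copy)
  have carrier: "\<exists>g. x = to_nat g \<and> g \<in> carrier G" if "x \<in> carrier (nat_copy G)" for x
    using that by (auto simp: nat_copy_def)
  show "double_act i x permutes copy True i \<union> copy False i" if "x \<in> carrier (nat_copy G)" for i x
    using carrier[OF that] double_act_permutes by blast
  show "filterlim (\<lambda>i. card (copy True i \<union> copy False i)) at_top sequentially"
    by (rule filterlim_at_top_mono[OF card_W]) (simp add: card_both_copies)
  fix x assume "x \<in> carrier (nat_copy G)"
  then obtain g where g: "x = to_nat g" "g \<in> carrier G" using carrier by blast
  show "(\<lambda>i. real (card {p \<in> copy True i \<union> copy False i. double_act i x (double_act i y p) = double_act i (x \<otimes>\<^bsub>nat_copy G\<^esub> y) p})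
      / real (card (copy True i \<union> copy False i))) \<longlonglongrightarrow> 1" if "y \<in> carrier (nat_copy G)" for y
  proof -
    obtain h where h: "y = to_nat h" "h \<in> carrier G" using carrier[OF \<open>y \<in> carrier (nat_copy G)\<close>] by blast
    have "x \<otimes>\<^bsub>nat_copy G\<^esub> y = to_nat (g \<otimes>\<^bsub>G\<^esub> h)" by (simp add: nat_copy_def g h)
    moreover have "double_act i (to_nat g) (double_act i (to_nat h) (to_nat (b, w))) = double_act i (to_nat (g \<otimes>\<^bsub>G\<^esub> h)) (to_nat (b, w))"
      if "w \<in> W i" for b :: bool and w i
      using that g h by (simp add: double_act_copy act_in act_mult)
    ultimately have "{p \<in> copy True i \<union> copy False i. double_act i x (double_act i y p) = double_act i (x \<otimes>\<^bsub>nat_copy G\<^esub> y) p}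
        = copy True i \<union> copy False i" for i
      by (auto simp: copy_def g h)
    moreover have "real (card (copy True i \<union> copy False i)) / real (card (copy True i \<union> copy False i)) = 1" for i
      using W_nonempty finite_W by (simp add: card_both_copies)
    ultimately show ?thesis by (simp only: tendsto_const)
  qed
  assume "x \<noteq> \<one>\<^bsub>nat_copy G\<^esub>"
  then have "g \<noteq> \<one>\<^bsub>G\<^esub>" by (auto simp: nat_copy_def g)
  moreover have "real (card {p \<in> copy True i \<union> copy False i. double_act i x p = p}) / real (card (copy True i \<union> copy False i))
      = real (card {w \<in> W i. act i g w = w}) / real (card (W i))" for i
    unfolding card_copies card_both_copies
    by (simp add: g double_act_copy cong: conj_cong)
  ultimately show "(\<lambda>i. real (card {p \<in> copy True i \<union> copy False i. double_act i x p = p})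
      / real (card (copy True i \<union> copy False i))) \<longlonglongrightarrow> 0"
    using fixed_points[OF g(2)] by simp
qed

lemma two_expanders: "two_expanders (nat_copy G) (to_nat ` F) (copy True) (copy False) double_act"
proof
  show "double_act i x n \<in> copy True i \<longleftrightarrow> n \<in> copy True i"
    if "x \<in> carrier (nat_copy G)" "n \<in> copy True i \<union> copy False i" for i x n
    using that by (auto simp: nat_copy_def copy_def double_act_copy act_in)
  show "copy True i \<noteq> {}" for i using W_nonempty by (simp add: copy_def)
  show "to_nat ` F \<subseteq> carrier (nat_copy G)" using F by (auto simp: nat_copy_def)
qed (simp_all add: F sofic_double_act disjoint_copies card_copy expander_copy)

end

section \<open>Failure of additivity\<close>

text \<open>The index is shifted because the frequency argument needs \<open>m \<ge> 3\<close>.\<close>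

interpretation plane_action: expanding_action affine_group generators "\<lambda>i. plane (i + 3)" "\<lambda>i. affine_map (i + 3)"
proof (rule expanding_action.intro)
  show "group affine_group" by (rule group_affine_group)
  show "finite generators" "generators \<subseteq> carrier affine_group"
    by (auto simp: generators_def affine_group_def)
  show "plane (i + 3) \<noteq> {}" for i using zero_in_plane by blast
  show "filterlim (\<lambda>i. card (plane (i + 3))) at_top sequentially"
  proof (rule filterlim_at_top_mono[OF filterlim_ident], rule always_eventually, rule allI)
    fix i :: nat
    have "i \<le> 2 ^ (i + 3)" using less_exp[of "i + 3"] by linarith
    also have "\<dots> \<le> 2 ^ (i + 3) * 2 ^ (i + 3)" by simp
    finally show "i \<le> card (plane (i + 3))" by (simp add: card_plane)
  qed
qed (auto simp: finite_plane affine_group_def affine_map_bij affine_map_mult plane_expander_sequence intro: fixed_point_ratio)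

theorem theorem6p4:
  shows "\<exists>(G :: nat monoid) (V :: nat \<Rightarrow> nat set) (\<sigma> :: nat \<Rightarrow> nat \<Rightarrow> nat \<Rightarrow> nat)
            (X :: real topology) (\<mu> :: real measure) (T :: nat \<Rightarrow> real \<Rightarrow> real).
     sofic_group G \<and> sofic_approximation G V \<sigma> \<and> compact_pmp_action G X \<mu> T \<and>
     (\<forall>\<rho> \<rho>'. generating_pseudometric G X T \<rho> \<longrightarrow>
        generating_pseudometric G (prod_topology X X) (diagonal_action X T) \<rho>' \<longrightarrow>
        sofic_entropy G V \<sigma> (prod_topology X X) (\<mu> \<Otimes>\<^sub>M \<mu>) (diagonal_action X T) \<rho>' = -\<infinity> \<and>
        (-\<infinity> :: ereal) \<noteq> 0 \<and>
        0 = 2 * sofic_entropy G V \<sigma> X \<mu> T \<rho>)"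
proof -
  let ?G = "nat_copy affine_group" and ?\<sigma> = "plane_action.double_act"
  let ?X = "discrete_topology {0, 1 :: real}" and ?T = "trivial_action {0, 1 :: real} :: nat \<Rightarrow> real \<Rightarrow> real"
  interpret two_expanders ?G "to_nat ` generators" "plane_action.copy True" "plane_action.copy False" ?\<sigma>
    by (rule plane_action.two_expanders)
  have "group ?G" by (rule group_nat_copy[OF group_affine_group])
  then have "sofic_group ?G"
    unfolding sofic_group_def using sofic by blast
  moreover have "compact_pmp_action ?G ?X fair_coin ?T"
    using \<open>group ?G\<close> fair_coin_Prob by (intro trivial_action_compact_pmp) auto
  moreover have "sofic_entropy ?G V ?\<sigma> (prod_topology ?X ?X) (fair_coin \<Otimes>\<^sub>M fair_coin) (diagonal_action ?X ?T) \<rho> = -\<infinity>"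
    if "generating_pseudometric ?G (prod_topology ?X ?X) (diagonal_action ?X ?T) \<rho>" for \<rho>
    using that entropy_fair_coin_square
    by (simp only: diagonal_trivial_action prod_topology_discrete_topology[symmetric])
  moreover have "sofic_entropy ?G V ?\<sigma> ?X fair_coin ?T \<rho> = 0" if "generating_pseudometric ?G ?X ?T \<rho>" for \<rho>
    using entropy_fair_coin_nonneg[OF that] entropy_fair_coin_nonpos[OF that] by (rule antisym[rotated])
  ultimately show ?thesis
    by (intro exI[of _ ?G] exI[of _ V] exI[of _ ?\<sigma>] exI[of _ ?X] exI[of _ fair_coin] exI[of _ ?T])
      (simp add: sofic)
qed

end
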